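(* Let $\Omega\subset X$ be a $\nu$-measurable set with $0<\nu(\Omega)<\nu(X)$. There exists $\lambda(\Omega)$ satisfying $$\max\{\lambda_\Omega^m,\lambda_{X\setminus\Omega}^m\}\le\lambda(\Omega)\le\lambda_*(\Omega)$$ and $$\begin{cases}\chi_\Omega\notin M(\chi_\Omega,\lambda)&\text{if }0<\lambda<\lambda(\Omega),\\ \chi_\Omega\in M(\chi_\Omega,\lambda(\Omega)),&\\ \{\chi_\Omega\}=M(\chi_\Omega,\lambda)&\text{if }\lambda>\lambda(\Omega).\end{cases}$$ Furthermore, $$\lambda(\Omega)=\lambda_\Omega^m\ \text{ if, and only if, }\ \left(\lambda_\Omega^m,\tfrac1{\nu(\Omega)}\chi_\Omega\right)\text{ is an }m\text{-eigenpair},$$ and $$\lambda(\Omega)=\lambda_{X\setminus\Omega}^m\ \text{ if, and only if, }\ \left(\lambda_{X\setminus\Omega}^m,\tfrac1{\nu(X\setminus\Omega)}\chi_{X\setminus\Omega}\right)\text{ is an }m\text{-eigenpair}.$$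
   Context: Setting: $(X,d)$ is a Polish metric space with its Borel $\sigma$-algebra. A random walk $m=(m_x)_{x\in X}$ on $X$ is a family of Borel probability measures on $X$ such that $x\mapsto m_x(A)$ is Borel for every Borel $A\subset X$ and $\int_X d(z,y)\,dm_x(y)<\infty$ for all $x\in X$ and some (hence any) $z\in X$; $[X,d,m]$ is a metric random walk space. $\nu$ is a finite (nonzero) Radon measure on $X$ which is reversible for $m$: $dm_x(y)d\nu(x)=dm_y(x)d\nu(y)$ as measures on $X\times X$ (this implies invariance, $\nu(A)=\int_X m_x(A)\,d\nu(x)$). It is also assumed that $\frac1{\nu(X)}\nu$ is ergodic with respect to $m$: every Borel set $B$ with $m_x(B)=1$ for all $x\in B$ satisfies $\nu(B)=0$ or $\nu(B)=\nu(X)$. $m$-total variation: $TV_m(u)=\frac12\int_X\int_X|u(y)-u(x)|\,dm_x(y)\,d\nu(x)$. $m$-perimeter: $P_m(E)=\int_E\int_{X\setminus E}dm_x(y)\,d\nu(x)$. For $0<\nu(\Omega)<\nu(X)$: $\lambda_\Omega^m=\frac{P_m(\Omega)}{\nu(\Omega)}$, and $\lambda_*(\Omega)=\|\chi_\Omega-m_{(\cdot)}(\Omega)\|_{L^\infty(X,\nu)}$, where $m_{(\cdot)}(\Omega)$ is the function $x\mapsto m_x(\Omega)$. $\mathcal E_m(u,f,\lambda)=TV_m(u)+\lambda\int_X|u-f|\,d\nu$, and $M(f,\lambda)$ is the set of $u\in L^1(X,\nu)$ minimizing $\mathcal E_m(\cdot,f,\lambda)$ over $L^1(X,\nu)$.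 $\mathcal F_m(u)=TV_m(u)$ on $L^2(X,\nu)$ (value $+\infty$ where $TV_m(u)=\infty$), with subdifferential $\partial\mathcal F_m$ in $L^2(X,\nu)$; $\Delta_1^m$ is the multivalued operator with $v\in\Delta_1^m u$ iff $-v\in\partial\mathcal F_m(u)$. A pair $(\lambda,u)\in\mathbb R\times L^2(X,\nu)$ is an $m$-eigenpair of $\Delta_1^m$ if $\|u\|_{L^1(X,\nu)}=1$ and there is $\xi\in\mathrm{sign}(u)$ with $\lambda\xi\in-\Delta_1^m u$ (i.e. $\lambda\xi\in\partial\mathcal F_m(u)$). Here $\xi\in\mathrm{sign}(u)$ means $\xi$ is $\nu$-measurable and, $\nu$-a.e., $\xi=1$ where $u>0$, $\xi=-1$ where $u<0$, $\xi\in[-1,1]$ where $u=0$. *)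

theory Defs
  imports "HOL-Probability.Probability"
begin

text \<open>
  The Polish metric space \<open>X\<close> is the universe of a type of class \<open>polish_space\<close>. The measures
  \<open>m x\<close> and \<open>\<nu>\<close> are Borel measures; \<open>\<nu>\<close>-measurable sets and functions, and the spaces of
  \<open>p\<close>-integrable functions, refer to \<open>completion \<nu>\<close>. If \<open>\<nu>\<close> is invariant, a \<open>\<nu>\<close>-measurable set or
  function is measurable for \<open>completion (m x)\<close> for \<open>\<nu>\<close>-almost every \<open>x\<close>, and its \<open>m x\<close>-measure or
  \<open>m x\<close>-integral is a \<open>\<nu>\<close>-measurable function of \<open>x\<close>, so the iterated integrals below are meaningful.
  Elements of \<open>L\<^sup>1\<close> and \<open>L\<^sup>2\<close> are represented by functions.
\<close>

definition random_walk :: "('a::polish_space \<Rightarrow> 'a measure) \<Rightarrow> bool" where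
  "random_walk m \<longleftrightarrow>
     (\<forall>x. prob_space (m x) \<and> sets (m x) = sets borel) \<and>
     (\<forall>A\<in>sets borel. (\<lambda>x. emeasure (m x) A) \<in> borel_measurable borel) \<and>
     (\<exists>z. \<forall>x. (\<integral>\<^sup>+ y. ennreal (dist z y) \<partial>m x) < \<infinity>)"

text \<open>A finite Borel measure on a Polish space is automatically Radon.\<close>

definition finite_nonzero_borel_measure :: "'a::polish_space measure \<Rightarrow> bool" where
  "finite_nonzero_borel_measure \<nu> \<longleftrightarrow>
     sets \<nu> = sets borel \<and> finite_measure \<nu> \<and> emeasure \<nu> UNIV \<noteq> 0"

text \<open>The measures \<open>dm\<^sub>x(y)d\<nu>(x)\<close> and \<open>dm\<^sub>y(x)d\<nu>(y)\<close> agree on every Borel subset of \<open>X \<times> X\<close>.\<close>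

definition reversible :: "('a::polish_space \<Rightarrow> 'a measure) \<Rightarrow> 'a measure \<Rightarrow> bool" where
  "reversible m \<nu> \<longleftrightarrow>
     (\<forall>C\<in>sets (borel :: ('a \<times> 'a) measure).
        (\<integral>\<^sup>+ x. (\<integral>\<^sup>+ y. indicator C (x, y) \<partial>m x) \<partial>\<nu>) =
        (\<integral>\<^sup>+ y. (\<integral>\<^sup>+ x. indicator C (x, y) \<partial>m y) \<partial>\<nu>))"

definition ergodic :: "('a::polish_space \<Rightarrow> 'a measure) \<Rightarrow> 'a measure \<Rightarrow> bool" where
  "ergodic m \<nu> \<longleftrightarrow>
     (\<forall>B\<in>sets borel. (\<forall>x\<in>B. emeasure (m x) B = 1) \<longrightarrow>
        emeasure \<nu> B = 0 \<or> emeasure \<nu> B = emeasure \<nu> UNIV)"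

definition L1 :: "'a measure \<Rightarrow> ('a \<Rightarrow> real) set" where
  "L1 \<nu> = {u. integrable (completion \<nu>) u}"

definition L2 :: "'a measure \<Rightarrow> ('a \<Rightarrow> real) set" where
  "L2 \<nu> = {u \<in> borel_measurable (completion \<nu>). integrable (completion \<nu>) (\<lambda>x. (u x)\<^sup>2)}"

definition TV :: "('a \<Rightarrow> 'a measure) \<Rightarrow> 'a measure \<Rightarrow> ('a \<Rightarrow> real) \<Rightarrow> ennreal" where
  "TV m \<nu> u =
     (\<integral>\<^sup>+ x. (\<integral>\<^sup>+ y. ennreal \<bar>u y - u x\<bar> \<partial>completion (m x)) \<partial>completion \<nu>) / 2"

definition perimeter :: "('a \<Rightarrow> 'a measure) \<Rightarrow> 'a measure \<Rightarrow> 'a set \<Rightarrow> real" where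
  "perimeter m \<nu> E = (LINT x:E|completion \<nu>. measure (completion (m x)) (- E))"

definition lambda_ratio :: "('a \<Rightarrow> 'a measure) \<Rightarrow> 'a measure \<Rightarrow> 'a set \<Rightarrow> real" where
  "lambda_ratio m \<nu> \<Omega> = perimeter m \<nu> \<Omega> / measure (completion \<nu>) \<Omega>"

definition lambda_star :: "('a \<Rightarrow> 'a measure) \<Rightarrow> 'a measure \<Rightarrow> 'a set \<Rightarrow> ereal" where
  "lambda_star m \<nu> \<Omega> =
     esssup (completion \<nu>)
       (\<lambda>x. ereal \<bar>indicat_real \<Omega> x - measure (completion (m x)) \<Omega>\<bar>)"

definition energy ::
  "('a \<Rightarrow> 'a measure) \<Rightarrow> 'a measure \<Rightarrow> ('a \<Rightarrow> real) \<Rightarrow> ('a \<Rightarrow> real) \<Rightarrow> real \<Rightarrow> ereal" where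
  "energy m \<nu> u f lam =
     enn2ereal (TV m \<nu> u) + ereal (lam * (LINT x|completion \<nu>. \<bar>u x - f x\<bar>))"

definition minimizers ::
  "('a \<Rightarrow> 'a measure) \<Rightarrow> 'a measure \<Rightarrow> ('a \<Rightarrow> real) \<Rightarrow> real \<Rightarrow> ('a \<Rightarrow> real) set" where
  "minimizers m \<nu> f lam =
     {u \<in> L1 \<nu>. \<forall>w\<in>L1 \<nu>. energy m \<nu> u f lam \<le> energy m \<nu> w f lam}"

text \<open>The element of \<open>L\<^sup>1\<close> represented by \<open>u\<close>, as a set of functions.\<close>

definition L1_class :: "'a measure \<Rightarrow> ('a \<Rightarrow> real) \<Rightarrow> ('a \<Rightarrow> real) set" where
  "L1_class \<nu> u = {w \<in> L1 \<nu>. AE x in completion \<nu>. w x = u x}"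

definition subdifferential ::
  "'a measure \<Rightarrow> (('a \<Rightarrow> real) \<Rightarrow> ereal) \<Rightarrow> ('a \<Rightarrow> real) \<Rightarrow> ('a \<Rightarrow> real) set" where
  "subdifferential \<nu> F u =
     {v \<in> L2 \<nu>. u \<in> L2 \<nu> \<and> F u < \<infinity> \<and>
        (\<forall>w\<in>L2 \<nu>. F u + ereal (LINT x|completion \<nu>. v x * (w x - u x)) \<le> F w)}"

definition TV_functional :: "('a \<Rightarrow> 'a measure) \<Rightarrow> 'a measure \<Rightarrow> ('a \<Rightarrow> real) \<Rightarrow> ereal" where
  "TV_functional m \<nu> u = enn2ereal (TV m \<nu> u)"

definition one_laplacian ::
  "('a \<Rightarrow> 'a measure) \<Rightarrow> 'a measure \<Rightarrow> ('a \<Rightarrow> real) \<Rightarrow> ('a \<Rightarrow> real) set" where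
  "one_laplacian m \<nu> u = {v. (\<lambda>x. - v x) \<in> subdifferential \<nu> (TV_functional m \<nu>) u}"

definition sign_selections :: "'a measure \<Rightarrow> ('a \<Rightarrow> real) \<Rightarrow> ('a \<Rightarrow> real) set" where
  "sign_selections \<nu> u =
     {\<xi> \<in> borel_measurable (completion \<nu>).
        AE x in completion \<nu>.
          (u x > 0 \<longrightarrow> \<xi> x = 1) \<and> (u x < 0 \<longrightarrow> \<xi> x = -1) \<and> (u x = 0 \<longrightarrow> \<xi> x \<in> {-1..1})}"

definition eigenpair ::
  "('a \<Rightarrow> 'a measure) \<Rightarrow> 'a measure \<Rightarrow> real \<Rightarrow> ('a \<Rightarrow> real) \<Rightarrow> bool" where
  "eigenpair m \<nu> lam u \<longleftrightarrow>
     u \<in> L2 \<nu> \<and> (LINT x|completion \<nu>. \<bar>u x\<bar>) = 1 \<and>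
     (\<exists>\<xi>\<in>sign_selections \<nu> u. (\<lambda>x. - (lam * \<xi> x)) \<in> one_laplacian m \<nu> u)"

end

theory Submission
  imports Defs
begin

text \<open>
  Write \<open>f\<close> for the indicator of \<open>\<Omega>\<close>, \<open>tv\<close> for the total variation and \<open>\<parallel>\<cdot>\<parallel>\<close> for the norm of \<open>L\<^sup>1\<close>. The
  function \<open>f\<close> minimizes its own energy for the parameter \<open>lam\<close> exactly if
  \<open>tv f \<le> tv w + lam * \<parallel>w - f\<parallel>\<close> for all \<open>w\<close>. The set of such \<open>lam\<close> is the half-line from
  \<open>\<Lambda> = sup (tv f - tv w) / \<parallel>w - f\<parallel>\<close> upwards (lemma \<open>stability_threshold\<close>), so this \<open>\<Lambda>\<close> is the
  threshold; beyond it the inequality is strict for \<open>w \<noteq> f\<close>, hence the minimizer is unique. The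
  competitors \<open>w = 0\<close> and \<open>w = 1\<close> give the two lower bounds of \<open>\<Lambda>\<close>.

  All other bounds come from duality. An antisymmetric flow \<open>\<sigma>\<close> on pairs with \<open>\<bar>\<sigma>\<bar> \<le> 1\<close> has the
  divergence \<open>v x = \<integral> \<sigma> (x, y) dm\<^sub>x(y)\<close>, and reversibility gives an integration by parts which shows
  \<open>\<integral> v * w \<le> tv w\<close>, with equality if \<open>\<sigma> (x, y)\<close> is a sign of \<open>w x - w y\<close>. The flow
  \<open>f x - f y\<close> is a sign of itself and has the divergence \<open>x \<mapsto> f x - m\<^sub>x(\<Omega>)\<close>; this identifies the
  perimeter with \<open>tv f\<close> and yields the upper bound of \<open>\<Lambda>\<close> by \<open>lambda_star\<close>.

  If \<open>(lam, f / \<nu>(\<Omega>))\<close> is an eigenpair for \<open>lam = tv f / \<nu>(\<Omega>)\<close>, the subgradient inequality for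
  \<open>lam * \<xi>\<close> and \<open>\<bar>\<xi>\<bar> \<le> 1\<close> give minimality of \<open>f\<close> at once. Conversely, minimality has to produce
  \<open>\<xi>\<close>, that is, a \<open>v\<close> with \<open>\<bar>v\<bar> \<le> lam\<close>, \<open>\<integral> v * w \<le> tv w\<close> and \<open>\<integral> v * f = tv f\<close> (a calibration;
  lemma \<open>calibration_of_minimizer\<close>). In the convex set of all \<open>v\<close> with the last two
  properties and \<open>\<bar>v\<bar> \<le> 1\<close> take one that minimizes the squared \<open>L\<^sup>2\<close> distance to the functions with values in
  \<open>[- lam, lam]\<close>, and let \<open>r\<close> be the part of \<open>v\<close> that exceeds \<open>[- lam, lam]\<close>. The sign flow of
  \<open>f - r / 3\<close> is also aligned with \<open>f\<close>, as \<open>f\<close> jumps by \<open>1\<close> and \<open>r / 3\<close> varies by less. Its divergence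
  therefore lies in the convex set, and comparing it with \<open>v\<close> turns minimality of \<open>f\<close> against
  the competitor \<open>f - r / 3\<close> into \<open>\<integral> r\<^sup>2 \<le> 0\<close>. Since \<open>v \<le> lam\<close> and \<open>\<integral> v * f = tv f = lam * \<nu>(\<Omega>)\<close>, the
  calibration equals \<open>lam\<close> on \<open>\<Omega>\<close>, so that \<open>lam * \<xi> = v\<close>
  for a selection \<open>\<xi>\<close> of the sign of \<open>f\<close>.

  The set \<open>X - \<Omega>\<close> has the same threshold because \<open>tv (1 - w) = tv w\<close>. The analysis is done for
  Borel functions and the measure \<open>\<nu>\<close>; Borel representatives carry it over to the completed measures.
\<close>

section \<open>The joint law of a point and its neighbour\<close>

locale reversible_walk =
  fixes m :: "'a::polish_space \<Rightarrow> 'a measure" and \<nu> :: "'a measure"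
  assumes rw: "random_walk m"
    and fin: "finite_nonzero_borel_measure \<nu>"
    and rev: "reversible m \<nu>"
begin

lemma sets_nu [simp, measurable_cong]: "sets \<nu> = sets borel"
  using fin by (simp add: finite_nonzero_borel_measure_def)

lemma space_nu [simp]: "space \<nu> = UNIV"
  using sets_eq_imp_space_eq[OF sets_nu] by simp

lemma sets_m [simp, measurable_cong]: "sets (m x) = sets borel"
  using rw by (simp add: random_walk_def)

lemma space_m [simp]: "space (m x) = UNIV"
  using sets_eq_imp_space_eq[OF sets_m] by simp

sublocale finite_measure \<nu>
  using fin by (simp add: finite_nonzero_borel_measure_def)

sublocale m: prob_space "m x" for x
  using rw by (simp add: random_walk_def)

lemma measurable_m [measurable]: "m \<in> \<nu> \<rightarrow>\<^sub>M subprob_algebra borel"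
proof (rule measurable_subprob_algebra)
  show "(\<lambda>x. emeasure (m x) A) \<in> borel_measurable \<nu>" if "A \<in> sets borel" for A
    using rw that by (auto simp: random_walk_def cong: measurable_cong_sets)
  show "subprob_space (m x)" for x
    by (rule m.subprob_space_axioms)
qed simp

text \<open>
  The measure \<open>dm\<^sub>x(y)d\<nu>(x)\<close> on pairs.
\<close>

definition joint :: "('a \<times> 'a) measure" where
  "joint = \<nu> \<bind> (\<lambda>x. distr (m x) (borel \<Otimes>\<^sub>M borel) (Pair x))"

lemma measurable_joint_kernel:
  "(\<lambda>x. distr (m x) (borel \<Otimes>\<^sub>M borel) (Pair x)) \<in> \<nu> \<rightarrow>\<^sub>M subprob_algebra (borel \<Otimes>\<^sub>M borel)"
  by (rule measurable_distr2[OF _ measurable_m]) simp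

lemma measurable_kernel_integral:
  fixes G :: "'a \<times> 'a \<Rightarrow> real"
  assumes [measurable]: "G \<in> borel_measurable (borel \<Otimes>\<^sub>M borel)"
  shows "(\<lambda>x. \<integral>y. G (x, y) \<partial>m x) \<in> borel_measurable \<nu>"
proof -
  have "(\<lambda>x. \<integral>p. G p \<partial>distr (m x) (borel \<Otimes>\<^sub>M borel) (Pair x)) \<in> borel_measurable \<nu>"
    by (rule measurable_compose[OF measurable_joint_kernel integral_measurable_subprob_algebra]) simp
  then show ?thesis by (simp add: integral_distr)
qed

lemma sets_joint [simp, measurable_cong]: "sets joint = sets (borel \<Otimes>\<^sub>M borel)"
  unfolding joint_def by (rule sets_bind_measurable[OF measurable_joint_kernel]) simp

lemma space_joint [simp]: "space joint = UNIV"
  using sets_eq_imp_space_eq[OF sets_joint] by (simp add: space_pair_measure)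

lemma nn_integral_joint:
  assumes [measurable]: "F \<in> borel_measurable (borel \<Otimes>\<^sub>M borel)"
  shows "(\<integral>\<^sup>+ p. F p \<partial>joint) = (\<integral>\<^sup>+ x. \<integral>\<^sup>+ y. F (x, y) \<partial>m x \<partial>\<nu>)"
  unfolding joint_def by (subst nn_integral_bind[OF assms measurable_joint_kernel])
    (simp add: nn_integral_distr)

lemma distr_joint_swap: "distr joint (borel \<Otimes>\<^sub>M borel) (\<lambda>(x, y). (y, x)) = joint"
proof (rule measure_eqI)
  fix C assume "C \<in> sets (distr joint (borel \<Otimes>\<^sub>M borel) (\<lambda>(x, y). (y, x)))"
  then have C [measurable]: "C \<in> sets (borel \<Otimes>\<^sub>M (borel :: 'a measure))" by simp
  have CB: "C \<in> sets (borel :: ('a \<times> 'a) measure)"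
    using C unfolding borel_prod .
  have "emeasure (distr joint (borel \<Otimes>\<^sub>M borel) (\<lambda>(x, y). (y, x))) C
      = (\<integral>\<^sup>+ p. indicator C p \<partial>distr joint (borel \<Otimes>\<^sub>M borel) (\<lambda>(x, y). (y, x)))"
    by simp
  also have "\<dots> = (\<integral>\<^sup>+ p. indicator C (case p of (x, y) \<Rightarrow> (y, x)) \<partial>joint)"
    by (subst nn_integral_distr) auto
  also have "\<dots> = (\<integral>\<^sup>+ y. \<integral>\<^sup>+ x. indicator C (x, y) \<partial>m y \<partial>\<nu>)"
    by (subst nn_integral_joint) auto
  also have "\<dots> = (\<integral>\<^sup>+ x. \<integral>\<^sup>+ y. indicator C (x, y) \<partial>m x \<partial>\<nu>)"
    using rev CB by (simp add: reversible_def)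
  also have "\<dots> = emeasure joint C"
    by (subst nn_integral_joint [symmetric]) auto
  finally show "emeasure (distr joint (borel \<Otimes>\<^sub>M borel) (\<lambda>(x, y). (y, x))) C = emeasure joint C" .
qed simp

lemma distr_joint_fst: "distr joint borel fst = \<nu>"
proof (rule measure_eqI)
  fix A assume "A \<in> sets (distr joint borel fst)"
  then have [measurable]: "A \<in> sets borel" by simp
  have "emeasure (distr joint borel fst) A = (\<integral>\<^sup>+ p. indicator A (fst p) \<partial>joint)"
    by (subst nn_integral_distr[of fst joint borel "indicator A", symmetric]) auto
  also have "\<dots> = emeasure \<nu> A"
    by (subst nn_integral_joint) (auto simp: m.emeasure_space_1[simplified])
  finally show "emeasure (distr joint borel fst) A = emeasure \<nu> A" .
qed simp

lemma distr_joint_snd: "distr joint borel snd = \<nu>"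
proof -
  have "distr joint borel snd = distr (distr joint (borel \<Otimes>\<^sub>M borel) (\<lambda>(x, y). (y, x))) borel snd"
    by (simp add: distr_joint_swap)
  also have "\<dots> = distr joint borel fst"
    by (subst distr_distr) (auto simp: comp_def case_prod_beta)
  finally show ?thesis by (simp add: distr_joint_fst)
qed

lemma integrable_joint_fst:
  fixes h :: "'a \<Rightarrow> real" assumes "integrable \<nu> h"
  shows "integrable joint (\<lambda>p. h (fst p))"
  by (rule integrable_distr[of fst joint borel]) (simp_all add: distr_joint_fst assms)

lemma integrable_joint_snd:
  fixes h :: "'a \<Rightarrow> real" assumes "integrable \<nu> h"
  shows "integrable joint (\<lambda>p. h (snd p))"
  by (rule integrable_distr[of snd joint borel]) (simp_all add: distr_joint_snd assms)

lemma integral_joint_swap: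
  fixes F :: "'a \<times> 'a \<Rightarrow> real"
  assumes [measurable]: "F \<in> borel_measurable (borel \<Otimes>\<^sub>M borel)"
  shows "(\<integral>p. F (snd p, fst p) \<partial>joint) = (\<integral>p. F p \<partial>joint)"
proof -
  have "(\<integral>p. F p \<partial>joint) = (\<integral>p. F p \<partial>distr joint (borel \<Otimes>\<^sub>M borel) (\<lambda>(x, y). (y, x)))"
    by (simp add: distr_joint_swap)
  also have "\<dots> = (\<integral>p. F (snd p, fst p) \<partial>joint)"
    by (subst integral_distr) (auto simp: case_prod_beta)
  finally show ?thesis by simp
qed

text \<open>
  By invariance of \<open>\<nu>\<close>, a \<open>\<nu>\<close>-null set is null for \<open>m x\<close> at
  almost every \<open>x\<close>. Hence changing a function on a \<open>\<nu>\<close>-null set does not affect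
  the iterated integrals.
\<close>

lemma AE_AE_m:
  assumes "AE x in \<nu>. P x"
  shows "AE x in \<nu>. AE y in m x. P y"
proof -
  obtain N where N: "N \<in> sets \<nu>" "emeasure \<nu> N = 0" "{x. \<not> P x} \<subseteq> N"
    using assms by (auto elim!: AE_E)
  then have [measurable]: "N \<in> sets borel" by simp
  have "(\<integral>\<^sup>+ x. emeasure (m x) N \<partial>\<nu>) = (\<integral>\<^sup>+ p. indicator N (snd p) \<partial>joint)"
    by (subst nn_integral_joint) auto
  also have "\<dots> = emeasure (distr joint borel snd) N"
    by (subst nn_integral_distr[of snd joint borel "indicator N", symmetric]) auto
  also have "\<dots> = 0"
    using N by (simp add: distr_joint_snd)
  finally have "AE x in \<nu>. emeasure (m x) N = 0"
    using measurable_emeasure_kernel[OF measurable_m, of N]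
    by (subst (asm) nn_integral_0_iff_AE) auto
  then show ?thesis
  proof eventually_elim
    case (elim x)
    then show ?case
      using N(3) by (intro AE_I[where N=N]) auto
  qed
qed

text \<open>
  Fubini's theorem for the kernel. The bound by a function of \<open>x\<close> alone makes all inner integrals
  finite, at every \<open>x\<close> and not only almost everywhere, so positive and negative part can be
  treated separately.
\<close>

lemma integral_joint:
  fixes F :: "'a \<times> 'a \<Rightarrow> real"
  assumes F [measurable]: "F \<in> borel_measurable (borel \<Otimes>\<^sub>M borel)"
    and h: "integrable \<nu> h" and bound: "\<And>x y. \<bar>F (x, y)\<bar> \<le> h x"
  shows "integrable joint F"
    and "(\<integral>p. F p \<partial>joint) = (\<integral>x. (\<integral>y. F (x, y) \<partial>m x) \<partial>\<nu>)"
proof -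
  show int: "integrable joint F"
    by (rule Bochner_Integration.integrable_bound[OF integrable_joint_fst[OF h]])
      (auto intro!: AE_I2 order_trans[OF bound abs_ge_self])
  have pos: "(\<integral>p. G p \<partial>joint) = (\<integral>x. (\<integral>y. G (x, y) \<partial>m x) \<partial>\<nu>) \<and> integrable \<nu> (\<lambda>x. \<integral>y. G (x, y) \<partial>m x)"
    if [measurable]: "G \<in> borel_measurable (borel \<Otimes>\<^sub>M borel)"
      and G: "\<And>x y. 0 \<le> G (x, y) \<and> G (x, y) \<le> h x" for G :: "'a \<times> 'a \<Rightarrow> real"
  proof -
    have Gx: "integrable (m x) (\<lambda>y. G (x, y))" for x
      using G by (intro m.integrable_const_bound[of _ "h x"]) auto
    have Gx': "(\<integral>\<^sup>+ y. G (x, y) \<partial>m x) = ennreal (\<integral>y. G (x, y) \<partial>m x)" for x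
      using G by (intro nn_integral_eq_integral Gx) auto
    have meas: "(\<lambda>x. \<integral>y. G (x, y) \<partial>m x) \<in> borel_measurable \<nu>"
      by (rule measurable_kernel_integral) simp
    have "integrable joint G"
      by (rule Bochner_Integration.integrable_bound[OF integrable_joint_fst[OF h]])
        (use G in \<open>auto intro!: AE_I2 intro: order_trans[OF _ abs_ge_self]\<close>)
    then have "ennreal (\<integral>p. G p \<partial>joint) = (\<integral>\<^sup>+ p. G p \<partial>joint)"
      using G by (intro nn_integral_eq_integral[symmetric]) auto
    also have "\<dots> = (\<integral>\<^sup>+ x. ennreal (\<integral>y. G (x, y) \<partial>m x) \<partial>\<nu>)"
      by (subst nn_integral_joint) (auto simp: Gx')
    finally have eq: "(\<integral>\<^sup>+ x. ennreal (\<integral>y. G (x, y) \<partial>m x) \<partial>\<nu>) = ennreal (\<integral>p. G p \<partial>joint)" ..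
    have nonneg: "0 \<le> (\<integral>y. G (x, y) \<partial>m x)" for x
      using G by (intro integral_nonneg_AE) auto
    have nonneg': "0 \<le> (\<integral>p. G p \<partial>joint)"
      using G by (intro integral_nonneg_AE) auto
    have "integrable \<nu> (\<lambda>x. \<integral>y. G (x, y) \<partial>m x)"
      by (rule integrableI_nonneg) (auto simp: meas nonneg eq)
    moreover from this have "ennreal (\<integral>x. (\<integral>y. G (x, y) \<partial>m x) \<partial>\<nu>) = ennreal (\<integral>p. G p \<partial>joint)"
      using nonneg by (subst eq[symmetric], subst nn_integral_eq_integral) auto
    ultimately show ?thesis
      using nonneg nonneg' by (auto simp: integral_nonneg_AE)
  qed
  let ?p = "\<lambda>p. max 0 (F p)" and ?n = "\<lambda>p. max 0 (- F p)"
  have h0: "0 \<le> h x" for x using bound[of x x] by linarith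
  have "(\<integral>p. F p \<partial>joint) = (\<integral>p. ?p p - ?n p \<partial>joint)"
    by (intro Bochner_Integration.integral_cong) auto
  also have "\<dots> = (\<integral>p. ?p p \<partial>joint) - (\<integral>p. ?n p \<partial>joint)"
    using int by (intro Bochner_Integration.integral_diff) auto
  also have "\<dots> = (\<integral>x. (\<integral>y. ?p (x, y) \<partial>m x) - (\<integral>y. ?n (x, y) \<partial>m x) \<partial>\<nu>)"
    using pos[of ?p] pos[of ?n] bound h0 by (subst Bochner_Integration.integral_diff) (auto simp: abs_le_iff)
  also have "\<dots> = (\<integral>x. (\<integral>y. F (x, y) \<partial>m x) \<partial>\<nu>)"
  proof (intro Bochner_Integration.integral_cong refl)
    fix x
    have "integrable (m x) (\<lambda>y. F (x, y))"
      using bound by (intro m.integrable_const_bound[of _ "h x"]) auto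
    then have "(\<integral>y. ?p (x, y) \<partial>m x) - (\<integral>y. ?n (x, y) \<partial>m x) = (\<integral>y. ?p (x, y) - ?n (x, y) \<partial>m x)"
      by (intro Bochner_Integration.integral_diff [symmetric]) auto
    also have "\<dots> = (\<integral>y. F (x, y) \<partial>m x)"
      by (intro Bochner_Integration.integral_cong) auto
    finally show "(\<integral>y. ?p (x, y) \<partial>m x) - (\<integral>y. ?n (x, y) \<partial>m x) = (\<integral>y. F (x, y) \<partial>m x)" .
  qed
  finally show "(\<integral>p. F p \<partial>joint) = (\<integral>x. (\<integral>y. F (x, y) \<partial>m x) \<partial>\<nu>)" .
qed

end

section \<open>Minimizing convex integrals over bounded functions\<close>

text \<open>
  The bound \<open>\<bar>a\<bar> \<le> (2\<^sup>n a\<^sup>2 + 2\<^sup>-\<^sup>n) / 2\<close> turns the quadratic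
  decay into summability of the \<open>L\<^sup>1\<close> norms of the increments, so the increments are
  summable almost everywhere.
\<close>

lemma AE_convergent_if_fast_Cauchy:
  fixes V :: "nat \<Rightarrow> 'a \<Rightarrow> real"
  assumes "finite_measure M"
    and V [measurable]: "\<And>n. V n \<in> borel_measurable M"
    and bd: "\<And>n x. \<bar>V n x\<bar> \<le> 1"
    and fast: "\<And>n. (\<integral>x. (V (Suc n) x - V n x)\<^sup>2 \<partial>M) \<le> (1/4)^n"
  shows "AE x in M. convergent (\<lambda>n. V n x)"
proof -
  interpret finite_measure M by fact
  define D where "D n x = \<bar>V (Suc n) x - V n x\<bar>" for n x
  have [measurable]: "D n \<in> borel_measurable M" for n
    unfolding D_def by measurable
  have D2: "0 \<le> D n x" "D n x \<le> 2" for n x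
    using bd[of n x] bd[of "Suc n" x] by (auto simp: D_def)
  have intD: "integrable M (D n)" for n
    using D2 by (intro integrable_const_bound[of _ 2]) auto
  have intD2: "integrable M (\<lambda>x. (D n x)\<^sup>2)" for n
    using power_mono[OF D2(2) D2(1), of _ _ 2] by (intro integrable_const_bound[of _ 4]) auto
  let ?c = "(1 + measure M (space M)) / 2"
  have le: "(\<integral>x. D n x \<partial>M) \<le> ?c * (1/2)^n" for n
  proof -
    have pt: "D n x \<le> (2^n * (D n x)\<^sup>2 + (1/2)^n) / 2" for x
    proof -
      have "0 \<le> (2^n * D n x - 1)\<^sup>2" by simp
      then have "2 * (2^n * D n x) \<le> (2^n * D n x)\<^sup>2 + 1"
        by (simp add: power2_eq_square algebra_simps)
      then have "(1/2)^n * (2 * (2^n * D n x)) \<le> (1/2)^n * ((2^n * D n x)\<^sup>2 + 1)"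
        by (intro mult_left_mono) auto
      then show ?thesis
        by (simp add: power2_eq_square field_simps)
    qed
    have "(\<integral>x. D n x \<partial>M) \<le> (\<integral>x. (2^n * (D n x)\<^sup>2 + (1/2)^n) / 2 \<partial>M)"
      using pt intD intD2 by (intro integral_mono) auto
    also have "\<dots> = (2^n * (\<integral>x. (D n x)\<^sup>2 \<partial>M) + (1/2)^n * measure M (space M)) / 2"
      using intD2 by simp
    also have "\<dots> \<le> (2^n * (1/4)^n + (1/2)^n * measure M (space M)) / 2"
      using fast[of n] by (simp add: D_def)
    also have "2^n * (1/4)^n = (1/2 :: real)^n"
      by (simp flip: power_mult_distrib)
    finally show ?thesis by (simp add: field_simps)
  qed
  have "(\<integral>\<^sup>+ x. (\<Sum>n. ennreal (D n x)) \<partial>M) = (\<Sum>n. \<integral>\<^sup>+ x. ennreal (D n x) \<partial>M)"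
    by (rule nn_integral_suminf) simp
  also have "\<dots> = (\<Sum>n. ennreal (\<integral>x. D n x \<partial>M))"
    using D2 intD by (intro suminf_cong nn_integral_eq_integral) auto
  also have "\<dots> \<le> (\<Sum>n. ennreal (?c * (1/2)^n))"
    by (intro suminf_le ennreal_leI le) auto
  also have "\<dots> = ennreal (\<Sum>n. ?c * (1/2)^n)"
    by (rule suminf_ennreal2) (auto intro!: summable_mult summable_geometric)
  also have "\<dots> < \<infinity>" by simp
  finally have "AE x in M. (\<Sum>n. ennreal (D n x)) \<noteq> \<infinity>"
    by (intro nn_integral_PInf_AE) auto
  then show ?thesis
  proof eventually_elim
    case (elim x)
    then have "summable (\<lambda>n. D n x)"
      using D2 by (intro summable_suminf_not_top) auto
    then have "summable (\<lambda>n. V (Suc n) x - V n x)"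
      unfolding D_def by (rule summable_rabs_cancel)
    then have "convergent (\<lambda>n. \<Sum>i<n. V (Suc i) x - V i x)"
      by (simp add: summable_iff_convergent)
    then have "convergent (\<lambda>n. V n x - V 0 x)"
      unfolding sum_lessThan_telescope[of "\<lambda>n. V n x"] .
    from convergent_add[OF this convergent_const[of "V 0 x"]] show ?case by simp
  qed
qed

text \<open>
  The argument behind the element of least norm in a Hilbert space, for a decreasing sequence of convex sets:
  the infima of \<open>q\<close> (the squared norm) over \<open>A n\<close> increase to a limit, and by the
  parallelogram law, which is the assumption on \<open>d\<close> (the squared distance), near-minimizers in
  late sets are close to each other.
\<close>

lemma minimal_norm_sequence:
  fixes q :: "'b \<Rightarrow> real"
  assumes sub: "decseq A" and ne: "\<And>n. A n \<noteq> {}"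
    and q: "\<And>n v. v \<in> A n \<Longrightarrow> 0 \<le> q v \<and> q v \<le> B"
    and par: "\<And>n v w. v \<in> A n \<Longrightarrow> w \<in> A n \<Longrightarrow> \<exists>z\<in>A n. d v w \<le> 2 * q v + 2 * q w - 4 * q z"
  obtains V where "\<And>n. V n \<in> A n" "\<And>n. d (V (Suc n)) (V n) \<le> (1/4)^n"
proof -
  define s where "s n = Inf (q ` A n)" for n
  have bdd: "bdd_below (q ` A n)" for n using q by (intro bdd_belowI[of _ 0]) auto
  have s_le: "s n \<le> q v" if "v \<in> A n" for n v
    unfolding s_def using bdd that by (intro cInf_lower) auto
  have s_approx: "\<exists>v\<in>A n. q v < s n + e" if "e > 0" for n e
    using cInf_lessD[of "q ` A n" "s n + e"] ne that unfolding s_def by auto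
  have "incseq s"
  proof (rule incseq_SucI)
    fix n
    show "s n \<le> s (Suc n)"
      unfolding s_def[of "Suc n"] using ne sub s_le[of _ n]
      by (intro cInf_greatest) (auto simp: decseq_Suc_iff)
  qed
  moreover have "s n \<le> B" for n
    using ne[of n] s_le q by force
  ultimately obtain L where L: "s \<longlonglongrightarrow> L" "\<And>n. s n \<le> L"
    using incseq_convergent[of s B] by blast
  have "\<exists>k. \<forall>n\<ge>k. L - s n < (1/4)^j / 16" for j
  proof -
    have "eventually (\<lambda>n. s n > L - (1/4)^j / 16) sequentially"
      using L(1) by (rule order_tendstoD) simp
    then show ?thesis
      unfolding eventually_sequentially by (elim ex_forward all_forward imp_forward) auto
  qed
  then obtain k0 where k0: "\<And>j n. n \<ge> k0 j \<Longrightarrow> L - s n < (1/4)^j / 16" by metis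
  \<comment> \<open>the partial sums make \<open>k\<close> monotone, the summand \<open>j\<close> keeps \<open>V j\<close> in \<open>A j\<close>\<close>
  define k where "k j = j + (\<Sum>i\<le>j. k0 i)" for j
  have k: "k j \<ge> k0 j" "k j \<ge> j" "k j \<le> k (Suc j)" for j
    unfolding k_def by (auto intro: member_le_sum trans_le_add2)
  have "\<exists>v\<in>A (k j). q v < s (k j) + (1/4)^j / 16" for j
    by (rule s_approx) simp
  then obtain V where V: "\<And>j. V j \<in> A (k j)" "\<And>j. q (V j) < s (k j) + (1/4)^j / 16"
    by metis
  show thesis
  proof
    show "V n \<in> A n" for n
      using V(1)[of n] decseqD[OF sub k(2)[of n]] by auto
    show "d (V (Suc n)) (V n) \<le> (1/4)^n" for n
    proof -
      have "V (Suc n) \<in> A (k n)"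
        using V(1)[of "Suc n"] decseqD[OF sub k(3)[of n]] by auto
      then obtain z where z: "z \<in> A (k n)" "d (V (Suc n)) (V n) \<le> 2 * q (V (Suc n)) + 2 * q (V n) - 4 * q z"
        using par V(1)[of n] by blast
      moreover have "q (V (Suc n)) < L + (1/4)^n / 16"
      proof -
        have "(1/4::real)^(Suc n) \<le> (1/4)^n" by simp
        then show ?thesis using V(2)[of "Suc n"] L(2)[of "k (Suc n)"] by linarith
      qed
      moreover have "q (V n) < L + (1/4)^n / 16"
        using V(2)[of n] L(2)[of "k n"] by linarith
      moreover have "s (k n) \<le> q z" "L - s (k n) < (1/4)^n / 16"
        using s_le z k0 k by auto
      moreover have "(0::real) < (1/4)^n" by simp
      ultimately show ?thesis by linarith
    qed
  qed
qed

text \<open>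
  This replaces weak compactness. A minimizing sequence of the integral alone need not converge, but
  near-minimizers of least \<open>L\<^sup>2\<close> norm within the sublevel sets do, almost everywhere along
  the chosen sequence. The limit belongs to \<open>A\<close> by closedness, and the integrals converge by
  domination.
\<close>

lemma convex_integral_attains_minimum:
  fixes A :: "('a \<Rightarrow> real) set" and S :: "real \<Rightarrow> real"
  assumes "finite_measure M" and "A \<noteq> {}"
    and meas: "\<And>v. v \<in> A \<Longrightarrow> v \<in> borel_measurable M"
    and bd: "\<And>v x. v \<in> A \<Longrightarrow> \<bar>v x\<bar> \<le> 1"
    and mid: "\<And>v w. v \<in> A \<Longrightarrow> w \<in> A \<Longrightarrow> (\<lambda>x. (v x + w x) / 2) \<in> A"
    and closed: "\<And>V v. (\<And>n. V n \<in> A) \<Longrightarrow> v \<in> borel_measurable M \<Longrightarrow> (\<And>x. \<bar>v x\<bar> \<le> 1) \<Longrightarrow>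
      (AE x in M. (\<lambda>n. V n x) \<longlonglongrightarrow> v x) \<Longrightarrow> v \<in> A"
    and S: "continuous_on UNIV S" "\<And>a b. S ((a + b) / 2) \<le> (S a + S b) / 2"
  shows "\<exists>v\<in>A. \<forall>w\<in>A. (\<integral>x. S (v x) \<partial>M) \<le> (\<integral>x. S (w x) \<partial>M)"
proof -
  interpret finite_measure M by fact
  have [measurable]: "S \<in> borel_measurable borel"
    using S(1) by (rule borel_measurable_continuous_onI)
  note meas [measurable]
  have "compact (S ` {-1..1})"
    using S(1) by (intro compact_continuous_image) (auto intro: continuous_on_subset)
  then obtain B where B: "\<And>a. \<bar>a\<bar> \<le> 1 \<Longrightarrow> \<bar>S a\<bar> \<le> B"
    using compact_imp_bounded[of "S ` {-1..1}"] by (force simp: bounded_real abs_le_iff)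
  define \<phi> where "\<phi> v = (\<integral>x. S (v x) \<partial>M)" for v
  define q where "q v = (\<integral>x. (v x)\<^sup>2 \<partial>M)" for v :: "'a \<Rightarrow> real"
  define d where "d v w = (\<integral>x. (v x - w x)\<^sup>2 \<partial>M)" for v w :: "'a \<Rightarrow> real"
  have intS: "integrable M (\<lambda>x. S (v x))" if "v \<in> A" for v
    using B bd that by (intro integrable_const_bound[of _ B]) auto
  have intq: "integrable M (\<lambda>x. (v x)\<^sup>2)" if "v \<in> A" for v
    using bd[OF that] that by (intro integrable_const_bound[of _ 1]) (auto simp: abs_square_le_1)
  have \<phi>_mid: "\<phi> (\<lambda>x. (v x + w x) / 2) \<le> (\<phi> v + \<phi> w) / 2" if "v \<in> A" "w \<in> A" for v w
  proof -
    have "\<phi> (\<lambda>x. (v x + w x) / 2) \<le> (\<integral>x. (S (v x) + S (w x)) / 2 \<partial>M)"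
      unfolding \<phi>_def
    proof (rule integral_mono)
      show "S ((v x + w x) / 2) \<le> (S (v x) + S (w x)) / 2" for x
        by (rule S(2))
      show "integrable M (\<lambda>x. S ((v x + w x) / 2))"
        by (rule intS[OF mid[OF that]])
      show "integrable M (\<lambda>x. (S (v x) + S (w x)) / 2)"
        using intS[OF that(1)] intS[OF that(2)] by simp
    qed
    then show ?thesis using intS[OF that(1)] intS[OF that(2)] by (simp add: \<phi>_def)
  qed
  have \<phi>_lower: "- B * measure M (space M) \<le> \<phi> v" if "v \<in> A" for v
  proof -
    have "(\<integral>x. - B \<partial>M) \<le> \<phi> v"
      unfolding \<phi>_def
    proof (rule integral_mono)
      show "- B \<le> S (v x)" for x
        using B[OF bd[OF that, of x]] by linarith
    qed (simp_all add: intS[OF that])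
    then show ?thesis by (simp add: mult.commute)
  qed
  have q_bd: "0 \<le> q v \<and> q v \<le> measure M (space M)" if "v \<in> A" for v
  proof -
    have "q v \<le> (\<integral>x. 1 \<partial>M)"
      unfolding q_def
    proof (rule integral_mono)
      show "(v x)\<^sup>2 \<le> 1" for x
        using bd[OF that, of x] by (simp add: abs_square_le_1)
    qed (simp_all add: intq[OF that])
    then show ?thesis by (auto simp: q_def)
  qed
  have par: "d v w = 2 * q v + 2 * q w - 4 * q (\<lambda>x. (v x + w x) / 2)" if "v \<in> A" "w \<in> A" for v w
  proof -
    have "d v w = (\<integral>x. 2 * (v x)\<^sup>2 + 2 * (w x)\<^sup>2 - 4 * ((v x + w x) / 2)\<^sup>2 \<partial>M)"
      unfolding d_def by (intro Bochner_Integration.integral_cong) (auto simp: power2_eq_square field_simps)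
    then show ?thesis
      using intq[OF that(1)] intq[OF that(2)] intq[OF mid[OF that]] by (simp add: q_def)
  qed
  define I where "I = Inf (\<phi> ` A)"
  have I_le: "I \<le> \<phi> v" if "v \<in> A" for v
    unfolding I_def using that \<phi>_lower by (intro cInf_lower bdd_belowI2) auto
  define An where "An n = {v \<in> A. \<phi> v \<le> I + 1 / Suc n}" for n :: nat
  obtain V where V: "\<And>n. V n \<in> An n" "\<And>n. d (V (Suc n)) (V n) \<le> (1/4)^n"
  proof (rule minimal_norm_sequence[of An q "measure M (space M)" d])
    show "decseq An"
    proof (rule decseq_SucI)
      fix n
      have "1 / real (Suc (Suc n)) \<le> 1 / real (Suc n)"
        by (rule divide_left_mono) auto
      then show "An (Suc n) \<subseteq> An n"
        unfolding An_def by (auto simp del: of_nat_Suc)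
    qed
    show "An n \<noteq> {}" for n
      using cInf_lessD[of "\<phi> ` A" "I + 1 / Suc n"] \<open>A \<noteq> {}\<close>
      unfolding I_def An_def by (auto intro: less_imp_le)
    show "0 \<le> q v \<and> q v \<le> measure M (space M)" if "v \<in> An n" for n v
      using q_bd that by (simp add: An_def)
    show "\<exists>z\<in>An n. d v w \<le> 2 * q v + 2 * q w - 4 * q z" if "v \<in> An n" "w \<in> An n" for n v w
      using that par[of v w] \<phi>_mid[of v w] mid[of v w]
      by (intro bexI[of _ "\<lambda>x. (v x + w x) / 2"]) (auto simp: An_def)
  qed blast
  have VA: "V n \<in> A" for n using V(1) by (simp add: An_def)
  have [measurable]: "V n \<in> borel_measurable M" for n using VA meas by blast
  have conv: "AE x in M. convergent (\<lambda>n. V n x)"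
    using V(2) VA bd by (intro AE_convergent_if_fast_Cauchy finite_measure_axioms) (auto simp: d_def)
  \<comment> \<open>the value of \<open>lim\<close> is arbitrary where the sequence diverges; clamping bounds it there\<close>
  define v where "v x = max (-1) (min 1 (lim (\<lambda>n. V n x)))" for x
  have [measurable]: "v \<in> borel_measurable M" unfolding v_def by measurable
  have v_bd: "\<bar>v x\<bar> \<le> 1" for x by (auto simp: v_def)
  have lim: "AE x in M. (\<lambda>n. V n x) \<longlonglongrightarrow> v x"
    using conv
  proof eventually_elim
    case (elim x)
    then have l: "(\<lambda>n. V n x) \<longlonglongrightarrow> lim (\<lambda>n. V n x)" by (simp add: convergent_LIMSEQ_iff)
    have "lim (\<lambda>n. V n x) \<le> 1"
      using bd[OF VA] by (intro LIMSEQ_le_const2[OF l]) (auto simp: abs_le_iff)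
    moreover have "-1 \<le> lim (\<lambda>n. V n x)"
      using bd[OF VA] by (intro LIMSEQ_le_const[OF l]) (auto simp: abs_le_iff minus_le_iff)
    ultimately have "v x = lim (\<lambda>n. V n x)" by (simp add: v_def)
    then show ?case using l by simp
  qed
  have "v \<in> A" by (rule closed[OF VA _ v_bd lim]) simp
  have "(\<lambda>n. \<phi> (V n)) \<longlonglongrightarrow> \<phi> v"
    unfolding \<phi>_def
  proof (rule integral_dominated_convergence[where w="\<lambda>_. B"])
    show "AE x in M. (\<lambda>n. S (V n x)) \<longlonglongrightarrow> S (v x)"
      using lim
    proof eventually_elim
      case (elim x)
      show ?case
        using S(1) elim by (rule continuous_on_tendsto_compose) auto
    qed
  qed (use B bd VA in auto)
  moreover have "(\<lambda>n. I + 1 / Suc n) \<longlonglongrightarrow> I + 0"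
    by (intro tendsto_intros LIMSEQ_Suc lim_1_over_n)
  ultimately have "\<phi> v \<le> I + 0"
    by (rule LIMSEQ_le) (use V(1) in \<open>auto simp: An_def\<close>)
  then show ?thesis
    using \<open>v \<in> A\<close> I_le by (force simp: \<phi>_def)
qed

section \<open>Distance to an interval\<close>

text \<open>
  The displacement of \<open>a\<close> from its nearest point in \<open>[- lam, lam]\<close>.
\<close>

definition soft_threshold :: "real \<Rightarrow> real \<Rightarrow> real" where
  "soft_threshold lam a = a - max (- lam) (min lam a)"

lemma abs_soft_threshold_le:
  assumes "\<bar>c\<bar> \<le> lam" shows "\<bar>soft_threshold lam a\<bar> \<le> \<bar>a - c\<bar>"
  using assms by (auto simp: soft_threshold_def abs_le_iff max_def min_def)

lemma soft_threshold_eq_0_iff: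
  assumes "0 \<le> lam" shows "soft_threshold lam a = 0 \<longleftrightarrow> \<bar>a\<bar> \<le> lam"
  using assms by (auto simp: soft_threshold_def abs_le_iff max_def min_def)

lemma soft_threshold_mult:
  assumes "0 \<le> lam"
  shows "soft_threshold lam a * a = (soft_threshold lam a)\<^sup>2 + lam * \<bar>soft_threshold lam a\<bar>"
  using assms by (auto simp: soft_threshold_def max_def min_def power2_eq_square algebra_simps)

text \<open>
  The left-hand side is the squared distance of \<open>a + h\<close> from \<open>[- lam, lam]\<close>, the
  right-hand side its squared distance from the point of the interval nearest to \<open>a\<close>.
\<close>

lemma soft_threshold_sq_expansion:
  assumes "0 \<le> lam"
  shows "(soft_threshold lam (a + h))\<^sup>2
    \<le> (soft_threshold lam a)\<^sup>2 + 2 * soft_threshold lam a * h + h\<^sup>2"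
proof -
  let ?c = "max (- lam) (min lam a)"
  have "\<bar>soft_threshold lam (a + h)\<bar> \<le> \<bar>a + h - ?c\<bar>"
    using assms by (intro abs_soft_threshold_le) auto
  then have "(soft_threshold lam (a + h))\<^sup>2 \<le> (a + h - ?c)\<^sup>2"
    by (simp add: abs_le_square_iff)
  also have "a + h - ?c = soft_threshold lam a + h"
    by (simp add: soft_threshold_def)
  finally show ?thesis by (simp add: power2_sum)
qed

lemma soft_threshold_sq_midpoint:
  assumes "0 \<le> lam"
  shows "(soft_threshold lam ((a + b) / 2))\<^sup>2
    \<le> ((soft_threshold lam a)\<^sup>2 + (soft_threshold lam b)\<^sup>2) / 2"
proof -
  let ?P = "\<lambda>a. max (- lam) (min lam a)"
  have "\<bar>soft_threshold lam ((a + b) / 2)\<bar> \<le> \<bar>(a + b) / 2 - (?P a + ?P b) / 2\<bar>"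
    using assms by (intro abs_soft_threshold_le) (auto simp: abs_le_iff max_def min_def)
  then have "(soft_threshold lam ((a + b) / 2))\<^sup>2 \<le> ((a + b) / 2 - (?P a + ?P b) / 2)\<^sup>2"
    by (simp add: abs_le_square_iff)
  also have "(a + b) / 2 - (?P a + ?P b) / 2 = (soft_threshold lam a + soft_threshold lam b) / 2"
    by (simp add: soft_threshold_def field_simps)
  also have "((soft_threshold lam a + soft_threshold lam b) / 2)\<^sup>2
      \<le> ((soft_threshold lam a)\<^sup>2 + (soft_threshold lam b)\<^sup>2) / 2"
    using zero_le_power2[of "soft_threshold lam a - soft_threshold lam b"]
    by (simp add: power2_eq_square field_simps)
  finally show ?thesis .
qed

lemma continuous_on_soft_threshold: "continuous_on UNIV (soft_threshold lam)"
  unfolding soft_threshold_def [abs_def] by (intro continuous_intros)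

text \<open>
  Divide by \<open>t\<close> and let \<open>t\<close> tend to 0.
\<close>

lemma linear_coefficient_nonneg:
  fixes c H :: real
  assumes "\<And>t. 0 < t \<Longrightarrow> t \<le> 1 \<Longrightarrow> 0 \<le> 2 * t * c + t\<^sup>2 * H" and "0 \<le> H"
  shows "0 \<le> c"
proof (rule ccontr)
  assume "\<not> 0 \<le> c"
  then have c: "c < 0" by simp
  define t where "t = min 1 (- c / (1 + H))"
  have t: "0 < t" "t \<le> 1" using c assms(2) by (auto simp: t_def field_simps)
  have "t * H \<le> (- c / (1 + H)) * H"
    using assms(2) by (intro mult_right_mono) (auto simp: t_def)
  also have "\<dots> \<le> - c"
    using c assms(2) by (simp add: field_simps)
  finally have "t * (2 * c + t * H) < 0"
    using t c by (intro mult_pos_neg) auto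
  then show False
    using assms(1)[OF t] by (simp add: power2_eq_square algebra_simps)
qed


section \<open>Total variation and divergences of flows\<close>

context reversible_walk
begin

definition tv :: "('a \<Rightarrow> real) \<Rightarrow> real" where
  "tv u = (\<integral>p. \<bar>u (snd p) - u (fst p)\<bar> \<partial>joint) / 2"

lemma integrable_joint_diff:
  fixes u :: "'a \<Rightarrow> real"
  assumes "integrable \<nu> u" shows "integrable joint (\<lambda>p. u (snd p) - u (fst p))"
  using integrable_joint_fst[OF assms] integrable_joint_snd[OF assms] by simp

lemma TV_eq_tv:
  assumes u: "integrable \<nu> u" shows "TV m \<nu> u = ennreal (tv u)"
proof -
  have [measurable]: "u \<in> borel_measurable borel"
    using borel_measurable_integrable[OF u] by simp
  have "TV m \<nu> u = (\<integral>\<^sup>+ p. ennreal \<bar>u (snd p) - u (fst p)\<bar> \<partial>joint) / 2"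
    unfolding TV_def nn_integral_completion by (subst nn_integral_joint) auto
  also have "\<dots> = ennreal (\<integral>p. \<bar>u (snd p) - u (fst p)\<bar> \<partial>joint) / 2"
    using integrable_joint_diff[OF u] by (subst nn_integral_eq_integral) auto
  also have "\<dots> = ennreal (tv u)"
    unfolding tv_def by (simp add: ennreal_divide_numeral)
  finally show ?thesis .
qed

lemma TV_cong_AE:
  assumes "AE x in \<nu>. u x = w x" shows "TV m \<nu> u = TV m \<nu> w"
proof -
  have "(\<integral>\<^sup>+ x. \<integral>\<^sup>+ y. ennreal \<bar>u y - u x\<bar> \<partial>m x \<partial>\<nu>) = (\<integral>\<^sup>+ x. \<integral>\<^sup>+ y. ennreal \<bar>w y - w x\<bar> \<partial>m x \<partial>\<nu>)"
  proof (rule nn_integral_cong_AE)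
    show "AE x in \<nu>. (\<integral>\<^sup>+ y. ennreal \<bar>u y - u x\<bar> \<partial>m x) = (\<integral>\<^sup>+ y. ennreal \<bar>w y - w x\<bar> \<partial>m x)"
      using assms AE_AE_m[OF assms]
    proof eventually_elim
      case (elim x)
      show ?case
        by (rule nn_integral_cong_AE, rule eventually_mono[OF elim(2)]) (simp add: elim(1))
    qed
  qed
  then show ?thesis unfolding TV_def nn_integral_completion by simp
qed

text \<open>
  The divergence of \<open>\<sigma>\<close>, seen as a flow from \<open>x\<close> to \<open>y\<close> along each
  pair \<open>(x, y)\<close>.
\<close>

definition flow_div :: "('a \<times> 'a \<Rightarrow> real) \<Rightarrow> 'a \<Rightarrow> real" where
  "flow_div \<sigma> x = (\<integral>y. \<sigma> (x, y) \<partial>m x)"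

lemma measurable_flow_div [measurable]:
  "\<sigma> \<in> borel_measurable (borel \<Otimes>\<^sub>M borel) \<Longrightarrow> flow_div \<sigma> \<in> borel_measurable borel"
  using measurable_kernel_integral[of \<sigma>] unfolding flow_div_def [abs_def] by simp

lemma abs_flow_div_le_1:
  assumes [measurable]: "\<sigma> \<in> borel_measurable (borel \<Otimes>\<^sub>M borel)" and "\<And>p. \<bar>\<sigma> p\<bar> \<le> 1"
  shows "\<bar>flow_div \<sigma> x\<bar> \<le> 1"
proof -
  have "\<bar>flow_div \<sigma> x\<bar> \<le> (\<integral>y. \<bar>\<sigma> (x, y)\<bar> \<partial>m x)"
    unfolding flow_div_def by (rule integral_abs_bound)
  also have "\<dots> \<le> 1"
    using assms(2) by (intro m.integral_le_const m.integrable_const_bound[of _ 1]) auto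
  finally show ?thesis .
qed

lemma integrable_bounded_mult:
  fixes v u :: "'a \<Rightarrow> real"
  assumes u: "integrable \<nu> u" and [measurable]: "v \<in> borel_measurable borel" and v: "\<And>x. \<bar>v x\<bar> \<le> 1"
  shows "integrable \<nu> (\<lambda>x. v x * u x)"
proof (rule Bochner_Integration.integrable_bound[OF u])
  show "AE x in \<nu>. norm (v x * u x) \<le> norm (u x)"
    using v by (auto simp: abs_mult intro!: mult_left_le_one_le)
  show "(\<lambda>x. v x * u x) \<in> borel_measurable \<nu>"
    using borel_measurable_integrable[OF u] by simp
qed

text \<open>
  Reversibility allows to exchange the two variables in the second half of the integral, where antisymmetry then
  produces a second copy of the first half.
\<close>

lemma flow_integration_by_parts:
  fixes u :: "'a \<Rightarrow> real"
  assumes \<sigma> [measurable]: "\<sigma> \<in> borel_measurable (borel \<Otimes>\<^sub>M borel)"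
    and bd: "\<And>p. \<bar>\<sigma> p\<bar> \<le> 1" and anti: "\<And>x y. \<sigma> (y, x) = - \<sigma> (x, y)"
    and u: "integrable \<nu> u"
  shows "integrable joint (\<lambda>p. \<sigma> p * (u (fst p) - u (snd p)))"
    and "(\<integral>p. \<sigma> p * (u (fst p) - u (snd p)) \<partial>joint) = 2 * (\<integral>x. flow_div \<sigma> x * u x \<partial>\<nu>)"
proof -
  have um [measurable]: "u \<in> borel_measurable borel"
    using borel_measurable_integrable[OF u] by simp
  have F: "(\<lambda>p. \<sigma> p * u (fst p)) \<in> borel_measurable (borel \<Otimes>\<^sub>M borel)" by measurable
  have bd': "\<bar>\<sigma> (x, y) * u (fst (x, y))\<bar> \<le> \<bar>u x\<bar>" for x y
    using bd by (auto simp: abs_mult intro!: mult_left_le_one_le)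
  have uabs: "integrable \<nu> (\<lambda>x. \<bar>u x\<bar>)" using u by simp
  note I = integral_joint[OF F uabs bd']
  have "integrable joint (\<lambda>p. \<sigma> p * u (snd p))"
    using bd by (intro Bochner_Integration.integrable_bound[OF integrable_joint_snd[OF u]])
      (auto simp: abs_mult intro!: mult_left_le_one_le)
  note I' = this
  show "integrable joint (\<lambda>p. \<sigma> p * (u (fst p) - u (snd p)))"
    using Bochner_Integration.integrable_diff[OF I(1) I'] by (simp add: algebra_simps)
  have "(\<integral>p. \<sigma> p * (u (fst p) - u (snd p)) \<partial>joint) = (\<integral>p. \<sigma> p * u (fst p) \<partial>joint) - (\<integral>p. \<sigma> p * u (snd p) \<partial>joint)"
    using Bochner_Integration.integral_diff[OF I(1) I'] by (simp add: algebra_simps)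
  also have "(\<integral>p. \<sigma> p * u (snd p) \<partial>joint) = (\<integral>p. \<sigma> (snd p, fst p) * u (fst p) \<partial>joint)"
    using integral_joint_swap[of "\<lambda>p. \<sigma> p * u (snd p)"] by simp
  also have "\<dots> = - (\<integral>p. \<sigma> p * u (fst p) \<partial>joint)"
    unfolding Bochner_Integration.integral_minus [symmetric]
    by (intro Bochner_Integration.integral_cong) (auto simp: anti)
  also have "(\<integral>p. \<sigma> p * u (fst p) \<partial>joint) = (\<integral>x. flow_div \<sigma> x * u x \<partial>\<nu>)"
    unfolding I(2) by (simp add: flow_div_def)
  finally show "(\<integral>p. \<sigma> p * (u (fst p) - u (snd p)) \<partial>joint) = 2 * (\<integral>x. flow_div \<sigma> x * u x \<partial>\<nu>)"
    by simp
qed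

lemma flow_div_le_tv:
  fixes u :: "'a \<Rightarrow> real"
  assumes \<sigma> [measurable]: "\<sigma> \<in> borel_measurable (borel \<Otimes>\<^sub>M borel)"
    and bd: "\<And>p. \<bar>\<sigma> p\<bar> \<le> 1" and anti: "\<And>x y. \<sigma> (y, x) = - \<sigma> (x, y)"
    and u: "integrable \<nu> u"
  shows "(\<integral>x. flow_div \<sigma> x * u x \<partial>\<nu>) \<le> tv u"
proof -
  have "(\<integral>p. \<sigma> p * (u (fst p) - u (snd p)) \<partial>joint) \<le> (\<integral>p. \<bar>u (snd p) - u (fst p)\<bar> \<partial>joint)"
  proof (rule integral_mono)
    show "\<sigma> p * (u (fst p) - u (snd p)) \<le> \<bar>u (snd p) - u (fst p)\<bar>" for p
    proof -
      have "\<sigma> p * (u (fst p) - u (snd p)) \<le> \<bar>\<sigma> p\<bar> * \<bar>u (fst p) - u (snd p)\<bar>"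
        unfolding abs_mult [symmetric] by (rule abs_ge_self)
      also have "\<dots> \<le> 1 * \<bar>u (fst p) - u (snd p)\<bar>"
        using bd by (intro mult_right_mono) auto
      finally show ?thesis by (simp add: abs_minus_commute)
    qed
  qed (use flow_integration_by_parts(1)[OF assms] integrable_joint_diff[OF u] in auto)
  then show ?thesis
    using flow_integration_by_parts(2)[OF assms] by (simp add: tv_def)
qed

lemma flow_div_eq_tv:
  fixes u :: "'a \<Rightarrow> real"
  assumes \<sigma> [measurable]: "\<sigma> \<in> borel_measurable (borel \<Otimes>\<^sub>M borel)"
    and bd: "\<And>p. \<bar>\<sigma> p\<bar> \<le> 1" and anti: "\<And>x y. \<sigma> (y, x) = - \<sigma> (x, y)"
    and u: "integrable \<nu> u"
    and aligned: "\<And>x y. \<sigma> (x, y) * (u x - u y) = \<bar>u x - u y\<bar>"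
  shows "(\<integral>x. flow_div \<sigma> x * u x \<partial>\<nu>) = tv u"
proof -
  have "(\<integral>p. \<sigma> p * (u (fst p) - u (snd p)) \<partial>joint) = (\<integral>p. \<bar>u (snd p) - u (fst p)\<bar> \<partial>joint)"
    using aligned by (intro Bochner_Integration.integral_cong) (auto simp: abs_minus_commute)
  then show ?thesis
    using flow_integration_by_parts(2)[OF \<sigma> bd anti u] by (simp add: tv_def)
qed

end

section \<open>Calibrations\<close>

context reversible_walk
begin

text \<open>
  The subgradient of the total variation at a minimizer, which would usually be obtained from the Hahn-Banach
  theorem and the duality of \<open>L\<^sup>1\<close> and \<open>L\<^sup>\<infinity>\<close>. Here a
  projection argument yields it: the minimizer \<open>v\<close> of the squared excess over \<open>lam\<close>
  is compared with the divergence of the sign flow of \<open>f - r / 3\<close>, where \<open>r\<close> is the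
  excess of \<open>v\<close>.
\<close>

lemma calibration_of_minimizer:
  fixes \<Omega> :: "'a set" and lam :: real
  defines "f \<equiv> indicat_real \<Omega>"
  assumes [measurable]: "\<Omega> \<in> sets borel" and lam: "0 \<le> lam"
    and opt: "\<And>w. integrable \<nu> w \<Longrightarrow> tv f \<le> tv w + lam * (\<integral>x. \<bar>w x - f x\<bar> \<partial>\<nu>)"
  shows "\<exists>v\<in>borel_measurable borel. (\<forall>x. \<bar>v x\<bar> \<le> 1) \<and> (AE x in \<nu>. \<bar>v x\<bar> \<le> lam) \<and>
    (\<forall>w. integrable \<nu> w \<longrightarrow> (\<integral>x. v x * w x \<partial>\<nu>) \<le> tv w) \<and> (\<integral>x. v x * f x \<partial>\<nu>) = tv f"
proof -
  have [measurable]: "f \<in> borel_measurable borel" unfolding f_def by simp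
  have f01: "f x = 0 \<or> f x = 1" for x by (auto simp: f_def indicator_def)
  then have f_bd: "\<bar>f x\<bar> \<le> 1" for x by (metis abs_one abs_zero order_refl zero_le_one)
  have int_f: "integrable \<nu> f" using f_bd by (intro integrable_const_bound[of _ 1]) auto
  let ?r = "soft_threshold lam"
  have [measurable]: "?r \<in> borel_measurable borel"
    by (rule borel_measurable_continuous_onI[OF continuous_on_soft_threshold])
  define A where "A = {v \<in> borel_measurable borel. (\<forall>x. \<bar>v x\<bar> \<le> 1) \<and>
    (\<forall>w. integrable \<nu> w \<longrightarrow> (\<integral>x. v x * w x \<partial>\<nu>) \<le> tv w) \<and> (\<integral>x. v x * f x \<partial>\<nu>) = tv f}"
  have A_meas: "v \<in> borel_measurable borel" and A_bd: "\<bar>v x\<bar> \<le> 1"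
    and A_le: "integrable \<nu> w \<Longrightarrow> (\<integral>x. v x * w x \<partial>\<nu>) \<le> tv w"
    and A_eq: "(\<integral>x. v x * f x \<partial>\<nu>) = tv f" if "v \<in> A" for v x w
    using that by (auto simp: A_def)
  have A_int: "integrable \<nu> (\<lambda>x. v x * w x)" if "v \<in> A" "integrable \<nu> w" for v w
    by (rule integrable_bounded_mult[OF that(2) A_meas[OF that(1)] A_bd[OF that(1)]])
  have A_convex: "(\<lambda>x. (1 - t) * v x + t * v' x) \<in> A"
    if v: "v \<in> A" and v': "v' \<in> A" and t: "0 \<le> t" "t \<le> 1" for v v' t
  proof -
    have [measurable]: "v \<in> borel_measurable borel" "v' \<in> borel_measurable borel"
      using A_meas v v' by auto
    have split: "(\<integral>x. ((1 - t) * v x + t * v' x) * w x \<partial>\<nu>)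
        = (1 - t) * (\<integral>x. v x * w x \<partial>\<nu>) + t * (\<integral>x. v' x * w x \<partial>\<nu>)" if "integrable \<nu> w" for w
      using A_int[OF v that] A_int[OF v' that] by (simp add: distrib_right mult.assoc)
    have "\<bar>(1 - t) * v x + t * v' x\<bar> \<le> 1" for x
    proof -
      have "\<bar>(1 - t) * v x + t * v' x\<bar> \<le> (1 - t) * \<bar>v x\<bar> + t * \<bar>v' x\<bar>"
        using t by (intro order_trans[OF abs_triangle_ineq]) (simp add: abs_mult)
      also have "\<dots> \<le> (1 - t) * 1 + t * 1"
        using t A_bd v v' by (intro add_mono mult_left_mono) auto
      finally show ?thesis by simp
    qed
    moreover have "(\<integral>x. ((1 - t) * v x + t * v' x) * w x \<partial>\<nu>) \<le> tv w" if "integrable \<nu> w" for w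
    proof -
      have "(\<integral>x. ((1 - t) * v x + t * v' x) * w x \<partial>\<nu>) \<le> (1 - t) * tv w + t * tv w"
        unfolding split[OF that] using t A_le[OF v that] A_le[OF v' that]
        by (intro add_mono mult_left_mono) auto
      then show ?thesis by (simp add: algebra_simps)
    qed
    moreover have "(\<integral>x. ((1 - t) * v x + t * v' x) * f x \<partial>\<nu>) = tv f"
      unfolding split[OF int_f] A_eq[OF v] A_eq[OF v'] by (simp add: algebra_simps)
    ultimately show ?thesis by (simp add: A_def)
  qed
  have flow_in_A: "flow_div \<sigma> \<in> A"
    if \<sigma>: "\<sigma> \<in> borel_measurable (borel \<Otimes>\<^sub>M borel)"
      and bd: "\<And>p. \<bar>\<sigma> p\<bar> \<le> 1" and anti: "\<And>x y. \<sigma> (y, x) = - \<sigma> (x, y)"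
      and aligned: "\<And>x y. \<sigma> (x, y) * (f x - f y) = \<bar>f x - f y\<bar>" for \<sigma>
    unfolding A_def
    using measurable_flow_div[OF \<sigma>] abs_flow_div_le_1[OF \<sigma> bd]
      flow_div_le_tv[OF \<sigma> bd anti] flow_div_eq_tv[OF \<sigma> bd anti int_f aligned] by blast
  have "\<exists>v\<in>A. \<forall>w\<in>A. (\<integral>x. (?r (v x))\<^sup>2 \<partial>\<nu>) \<le> (\<integral>x. (?r (w x))\<^sup>2 \<partial>\<nu>)"
  proof (rule convex_integral_attains_minimum[where S="\<lambda>a. (?r a)\<^sup>2", OF finite_measure_axioms])
    have "flow_div (\<lambda>(x, y). f x - f y) \<in> A"
    proof (rule flow_in_A)
      show "\<bar>case p of (x, y) \<Rightarrow> f x - f y\<bar> \<le> 1" for p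
        using f01[of "fst p"] f01[of "snd p"] by (auto simp: case_prod_beta)
      show "(case (x, y) of (x, y) \<Rightarrow> f x - f y) * (f x - f y) = \<bar>f x - f y\<bar>" for x y
        using f01[of x] f01[of y] by auto
    qed auto
    then show "A \<noteq> {}" by auto
    show "(\<lambda>x. (v x + w x) / 2) \<in> A" if "v \<in> A" "w \<in> A" for v w
      using A_convex[OF that, of "1/2"] by (simp add: add_divide_distrib)
    show "v \<in> A" if V: "\<And>n. V n \<in> A" and [measurable]: "v \<in> borel_measurable \<nu>"
      and v: "\<And>x. \<bar>v x\<bar> \<le> 1" and lim: "AE x in \<nu>. (\<lambda>n. V n x) \<longlonglongrightarrow> v x" for V v
    proof -
      have [measurable]: "V n \<in> borel_measurable borel" for n using V A_meas by auto
      have conv: "(\<lambda>n. \<integral>x. V n x * w x \<partial>\<nu>) \<longlonglongrightarrow> (\<integral>x. v x * w x \<partial>\<nu>)" if w: "integrable \<nu> w" for w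
      proof (rule integral_dominated_convergence[where w="\<lambda>x. \<bar>w x\<bar>"])
        have [measurable]: "w \<in> borel_measurable \<nu>" using w by simp
        show "(\<lambda>x. v x * w x) \<in> borel_measurable \<nu>" by simp
        show "(\<lambda>x. V n x * w x) \<in> borel_measurable \<nu>" for n by simp
        show "AE x in \<nu>. (\<lambda>n. V n x * w x) \<longlonglongrightarrow> v x * w x"
          using lim by eventually_elim (intro tendsto_intros)
        show "AE x in \<nu>. norm (V n x * w x) \<le> \<bar>w x\<bar>" for n
          using A_bd[OF V] by (auto simp: abs_mult intro!: mult_left_le_one_le)
      qed (use w in simp)
      have "(\<integral>x. v x * w x \<partial>\<nu>) \<le> tv w" if "integrable \<nu> w" for w
        using A_le[OF V that] by (intro LIMSEQ_le_const2[OF conv[OF that]]) auto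
      moreover have "(\<integral>x. v x * f x \<partial>\<nu>) = tv f"
        using conv[OF int_f] A_eq[OF V] by (simp add: LIMSEQ_const_iff)
      ultimately show ?thesis using v by (simp add: A_def)
    qed
  qed (use A_meas A_bd lam soft_threshold_sq_midpoint in
      \<open>auto intro!: continuous_intros continuous_on_soft_threshold\<close>)
  then obtain v where v: "v \<in> A"
    and v_min: "\<And>w. w \<in> A \<Longrightarrow> (\<integral>x. (?r (v x))\<^sup>2 \<partial>\<nu>) \<le> (\<integral>x. (?r (w x))\<^sup>2 \<partial>\<nu>)" by auto
  have [measurable]: "v \<in> borel_measurable borel" using A_meas[OF v] .
  define r where "r x = ?r (v x)" for x
  have [measurable]: "r \<in> borel_measurable borel" unfolding r_def by measurable
  have r_bd: "\<bar>r x\<bar> \<le> 1" for x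
    using abs_soft_threshold_le[of 0 lam "v x"] lam A_bd[OF v, of x] by (simp add: r_def)
  have int_bd: "integrable \<nu> g" if "g \<in> borel_measurable borel" "\<And>x. \<bar>g x\<bar> \<le> B" for g :: "'a \<Rightarrow> real" and B
    using that by (intro integrable_const_bound[of _ B]) auto
  have int_r: "integrable \<nu> r" using r_bd by (intro int_bd[of _ 1]) auto
  have int_r2: "integrable \<nu> (\<lambda>x. (r x)\<^sup>2)"
    using r_bd by (intro int_bd[of _ 1]) (auto simp: abs_square_le_1)
  \<comment> \<open>first-order condition at the minimizer \<open>v\<close>, in the direction of \<open>v'\<close>\<close>
  have variational: "(\<integral>x. v x * r x \<partial>\<nu>) \<le> (\<integral>x. v' x * r x \<partial>\<nu>)" if v': "v' \<in> A" for v'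
  proof -
    have [measurable]: "v' \<in> borel_measurable borel" using A_meas[OF v'] .
    define h where "h x = v' x - v x" for x
    have [measurable]: "h \<in> borel_measurable borel" unfolding h_def by measurable
    have h_bd: "\<bar>h x\<bar> \<le> 2" for x
      using A_bd[OF v, of x] A_bd[OF v', of x] unfolding h_def by linarith
    have int_h2: "integrable \<nu> (\<lambda>x. (h x)\<^sup>2)"
      using power_mono[OF h_bd, of _ 2] by (intro int_bd[of _ 4]) auto
    have int_rh: "integrable \<nu> (\<lambda>x. r x * h x)"
      using A_int[OF v int_r] A_int[OF v' int_r] by (simp add: h_def algebra_simps)
    have "0 \<le> (\<integral>x. r x * h x \<partial>\<nu>)"
    proof (rule linear_coefficient_nonneg)
      fix t :: real assume t: "0 < t" "t \<le> 1"
      let ?w = "\<lambda>x. (1 - t) * v x + t * v' x"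
      have w: "?w \<in> A" using A_convex[OF v v'] t by auto
      have rw: "\<bar>?r (?w x)\<bar> \<le> 1" for x
        using abs_soft_threshold_le[of 0 lam "?w x"] lam A_bd[OF w, of x] by simp
      have "(\<integral>x. (r x)\<^sup>2 \<partial>\<nu>) \<le> (\<integral>x. (?r (?w x))\<^sup>2 \<partial>\<nu>)"
        using v_min[OF w] by (simp add: r_def)
      also have "\<dots> \<le> (\<integral>x. (r x)\<^sup>2 + 2 * t * (r x * h x) + t\<^sup>2 * (h x)\<^sup>2 \<partial>\<nu>)"
      proof (rule integral_mono)
        show "integrable \<nu> (\<lambda>x. (?r (?w x))\<^sup>2)"
          using rw by (intro int_bd[of _ 1]) (auto simp: abs_square_le_1)
        show "integrable \<nu> (\<lambda>x. (r x)\<^sup>2 + 2 * t * (r x * h x) + t\<^sup>2 * (h x)\<^sup>2)"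
          using int_r2 int_rh int_h2 by simp
        show "(?r (?w x))\<^sup>2 \<le> (r x)\<^sup>2 + 2 * t * (r x * h x) + t\<^sup>2 * (h x)\<^sup>2" for x
          using soft_threshold_sq_expansion[OF lam, of "v x" "t * h x"]
          by (simp add: r_def h_def power_mult_distrib) (simp add: algebra_simps)
      qed
      also have "\<dots> = (\<integral>x. (r x)\<^sup>2 \<partial>\<nu>) + 2 * t * (\<integral>x. r x * h x \<partial>\<nu>) + t\<^sup>2 * (\<integral>x. (h x)\<^sup>2 \<partial>\<nu>)"
        using int_r2 int_rh int_h2 by simp
      finally show "0 \<le> 2 * t * (\<integral>x. r x * h x \<partial>\<nu>) + t\<^sup>2 * (\<integral>x. (h x)\<^sup>2 \<partial>\<nu>)" by simp
    qed simp
    also have "(\<integral>x. r x * h x \<partial>\<nu>) = (\<integral>x. v' x * r x \<partial>\<nu>) - (\<integral>x. v x * r x \<partial>\<nu>)"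
      using A_int[OF v int_r] A_int[OF v' int_r] by (simp add: h_def algebra_simps)
    finally show ?thesis by simp
  qed
  \<comment> \<open>\<open>r / 3\<close> varies by at most \<open>2/3\<close>, less than a jump of \<open>f\<close>, so \<open>w\<close> and \<open>f\<close> jump in the same direction\<close>
  define w where "w x = f x - r x / 3" for x
  have [measurable]: "w \<in> borel_measurable borel" unfolding w_def by measurable
  have int_w: "integrable \<nu> w" unfolding w_def using int_f int_r by simp
  define \<sigma> where "\<sigma> = (\<lambda>(x, y). sgn (w x - w y))"
  have \<sigma>_meas: "\<sigma> \<in> borel_measurable (borel \<Otimes>\<^sub>M borel)" unfolding \<sigma>_def by measurable
  have \<sigma>_bd: "\<bar>\<sigma> p\<bar> \<le> 1" for p by (auto simp: \<sigma>_def abs_sgn_eq split: prod.split)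
  have \<sigma>_anti: "\<sigma> (y, x) = - \<sigma> (x, y)" for x y
    by (simp add: \<sigma>_def) (metis minus_diff_eq sgn_minus)
  have \<sigma>_f: "\<sigma> (x, y) * (f x - f y) = \<bar>f x - f y\<bar>" for x y
    using f01[of x] f01[of y] r_bd[of x] r_bd[of y] by (auto simp: \<sigma>_def w_def sgn_if)
  have \<sigma>_w: "\<sigma> (x, y) * (w x - w y) = \<bar>w x - w y\<bar>" for x y
    by (auto simp: \<sigma>_def sgn_if)
  let ?v = "flow_div \<sigma>"
  have v'A: "?v \<in> A"
    by (rule flow_in_A) (fact \<sigma>_meas \<sigma>_bd \<sigma>_anti \<sigma>_f)+
  have "(\<integral>x. ?v x * w x \<partial>\<nu>) = tv w"
    by (rule flow_div_eq_tv) (fact \<sigma>_meas \<sigma>_bd \<sigma>_anti \<sigma>_w int_w)+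
  moreover have "(\<integral>x. ?v x * w x \<partial>\<nu>) = tv f - (\<integral>x. ?v x * r x \<partial>\<nu>) / 3"
    using A_int[OF v'A int_f] A_int[OF v'A int_r] A_eq[OF v'A]
    by (simp add: w_def right_diff_distrib)
  moreover have "lam * (\<integral>x. \<bar>w x - f x\<bar> \<partial>\<nu>) = lam * (\<integral>x. \<bar>r x\<bar> \<partial>\<nu>) / 3"
    by (simp add: w_def)
  ultimately have "(\<integral>x. ?v x * r x \<partial>\<nu>) \<le> lam * (\<integral>x. \<bar>r x\<bar> \<partial>\<nu>)"
    using opt[OF int_w] by linarith
  moreover have "(\<integral>x. v x * r x \<partial>\<nu>) = (\<integral>x. (r x)\<^sup>2 + lam * \<bar>r x\<bar> \<partial>\<nu>)"
    using soft_threshold_mult[OF lam] by (simp add: r_def mult.commute)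
  moreover have "\<dots> = (\<integral>x. (r x)\<^sup>2 \<partial>\<nu>) + lam * (\<integral>x. \<bar>r x\<bar> \<partial>\<nu>)"
    using int_r2 int_r by simp
  ultimately have "(\<integral>x. (r x)\<^sup>2 \<partial>\<nu>) \<le> 0"
    using variational[OF v'A] by simp
  then have "(\<integral>x. (r x)\<^sup>2 \<partial>\<nu>) = 0"
    by (intro antisym) auto
  then have "AE x in \<nu>. (r x)\<^sup>2 = 0"
    using int_r2 by (subst (asm) integral_nonneg_eq_0_iff_AE) auto
  then have "AE x in \<nu>. \<bar>v x\<bar> \<le> lam"
    by eventually_elim (simp add: r_def soft_threshold_eq_0_iff[OF lam])
  then show ?thesis
    using v by (auto simp: A_def)
qed

end

section \<open>Indicators and the stability threshold\<close>

context reversible_walk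
begin

lemma tv_scale: "tv (\<lambda>x. c * u x) = \<bar>c\<bar> * tv u"
  unfolding tv_def by (simp flip: right_diff_distrib add: abs_mult)

lemma tv_const: "tv (\<lambda>_. c) = 0"
  by (simp add: tv_def)

lemma tv_nonneg: "0 \<le> tv u"
  by (simp add: tv_def)

lemma tv_one_minus: "tv (\<lambda>x. 1 - u x) = tv u"
  unfolding tv_def by (simp add: abs_minus_commute)

lemma tv_clamp_le:
  assumes u: "integrable \<nu> u"
  shows "tv (\<lambda>x. max 0 (min 1 (u x))) \<le> tv u"
proof -
  have [measurable]: "u \<in> borel_measurable borel"
    using borel_measurable_integrable[OF u] by simp
  have "integrable \<nu> (\<lambda>x. max 0 (min 1 (u x)))"
    by (rule integrable_const_bound[of _ 1]) auto
  then have "(\<integral>p. \<bar>max 0 (min 1 (u (snd p))) - max 0 (min 1 (u (fst p)))\<bar> \<partial>joint) \<le> (\<integral>p. \<bar>u (snd p) - u (fst p)\<bar> \<partial>joint)"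
    by (intro integral_mono integrable_abs integrable_joint_diff[OF u]
        integrable_joint_diff[of "\<lambda>x. max 0 (min 1 (u x))"]) auto
  then show ?thesis by (simp add: tv_def)
qed

lemma integrable_indicator_real:
  "A \<in> sets borel \<Longrightarrow> integrable \<nu> (indicat_real A)"
  by (rule integrable_const_bound[of _ 1]) (auto simp: indicator_def)

text \<open>
  The difference of indicators is its own sign, so this is the sign flow of the indicator of \<open>A\<close>.
\<close>

definition cut_flow :: "'a set \<Rightarrow> 'a \<times> 'a \<Rightarrow> real" where
  "cut_flow A = (\<lambda>(x, y). indicat_real A x - indicat_real A y)"

lemma cut_flow:
  assumes [measurable]: "A \<in> sets borel"
  shows "cut_flow A \<in> borel_measurable (borel \<Otimes>\<^sub>M borel)"
    and "\<bar>cut_flow A p\<bar> \<le> 1"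
    and "cut_flow A (y, x) = - cut_flow A (x, y)"
    and "cut_flow A (x, y) * (indicat_real A x - indicat_real A y) = \<bar>indicat_real A x - indicat_real A y\<bar>"
    and "flow_div (cut_flow A) x = indicat_real A x - measure (m x) A"
proof -
  show "cut_flow A \<in> borel_measurable (borel \<Otimes>\<^sub>M borel)"
    unfolding cut_flow_def by measurable
  have int: "integrable (m x) (indicat_real A)"
    by (rule m.integrable_const_bound[of _ 1]) (auto simp: indicator_def)
  have "flow_div (cut_flow A) x = (\<integral>y. indicat_real A x - indicat_real A y \<partial>m x)"
    by (simp add: flow_div_def cut_flow_def)
  also have "\<dots> = indicat_real A x - measure (m x) A"
    using int m.prob_space[of x] by (subst Bochner_Integration.integral_diff) auto
  finally show "flow_div (cut_flow A) x = indicat_real A x - measure (m x) A" .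
qed (auto simp: cut_flow_def indicator_def split: prod.split)

lemma tv_indicator_eq:
  assumes "A \<in> sets borel"
  shows "tv (indicat_real A) = (\<integral>x. flow_div (cut_flow A) x * indicat_real A x \<partial>\<nu>)"
  by (rule flow_div_eq_tv[symmetric])
    (fact cut_flow[OF assms] integrable_indicator_real[OF assms])+

text \<open>
  The divergence of the cut flow is a subgradient of the total variation at the indicator of \<open>A\<close>.
\<close>

lemma tv_indicator_le:
  assumes A: "A \<in> sets borel" and w: "integrable \<nu> w"
    and c: "AE x in \<nu>. \<bar>flow_div (cut_flow A) x\<bar> \<le> c"
  shows "tv (indicat_real A) \<le> tv w + c * (\<integral>x. \<bar>w x - indicat_real A x\<bar> \<partial>\<nu>)"
proof -
  let ?f = "indicat_real A" and ?g = "flow_div (cut_flow A)"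
  have [measurable]: "A \<in> sets borel" by fact
  have g [measurable]: "?g \<in> borel_measurable borel"
    by (rule measurable_flow_div[OF cut_flow(1)[OF A]])
  have g_bd: "\<bar>?g x\<bar> \<le> 1" for x
    by (rule abs_flow_div_le_1) (fact cut_flow[OF A])+
  note int_f = integrable_indicator_real[OF A]
  note int = integrable_bounded_mult[OF _ g g_bd]
  have int_d: "integrable \<nu> (\<lambda>x. w x - ?f x)" using w int_f by simp
  have "tv ?f - tv w \<le> (\<integral>x. ?g x * ?f x \<partial>\<nu>) - (\<integral>x. ?g x * w x \<partial>\<nu>)"
    using tv_indicator_eq[OF A] flow_div_le_tv[OF cut_flow(1)[OF A] cut_flow(2)[OF A] cut_flow(3)[OF A] w]
    by simp
  also have "\<dots> = (\<integral>x. - (?g x * (w x - ?f x)) \<partial>\<nu>)"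
    using int[OF int_f] int[OF w] by (simp add: right_diff_distrib)
  also have "\<dots> \<le> (\<integral>x. c * \<bar>w x - ?f x\<bar> \<partial>\<nu>)"
  proof (rule integral_mono_AE)
    show "AE x in \<nu>. - (?g x * (w x - ?f x)) \<le> c * \<bar>w x - ?f x\<bar>"
      using c
    proof eventually_elim
      case (elim x)
      have "- (?g x * (w x - ?f x)) \<le> \<bar>?g x\<bar> * \<bar>w x - ?f x\<bar>"
        unfolding abs_mult [symmetric] by (rule abs_ge_minus_self)
      also have "\<dots> \<le> c * \<bar>w x - ?f x\<bar>"
        using elim by (rule mult_right_mono) simp
      finally show ?case .
    qed
    show "integrable \<nu> (\<lambda>x. - (?g x * (w x - ?f x)))"
      using int[OF int_d] by simp
    show "integrable \<nu> (\<lambda>x. c * \<bar>w x - ?f x\<bar>)"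
      using int_d by simp
  qed
  finally show ?thesis by simp
qed

text \<open>
  Minimality of \<open>f\<close> for its own energy, stated for Borel functions and real numbers.
\<close>

definition tv_stable :: "('a \<Rightarrow> real) \<Rightarrow> real \<Rightarrow> bool" where
  "tv_stable f lam \<longleftrightarrow>
    (\<forall>w. integrable \<nu> w \<longrightarrow> tv f \<le> tv w + lam * (\<integral>x. \<bar>w x - f x\<bar> \<partial>\<nu>))"

lemma tv_stable_one_minus:
  assumes "tv_stable f lam" shows "tv_stable (\<lambda>x. 1 - f x) lam"
  unfolding tv_stable_def
proof (intro allI impI)
  fix w :: "'a \<Rightarrow> real" assume "integrable \<nu> w"
  then have "integrable \<nu> (\<lambda>x. 1 - w x)" by simp
  then have "tv f \<le> tv (\<lambda>x. 1 - w x) + lam * (\<integral>x. \<bar>1 - w x - f x\<bar> \<partial>\<nu>)"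
    using assms by (simp add: tv_stable_def)
  also have "(\<integral>x. \<bar>1 - w x - f x\<bar> \<partial>\<nu>) = (\<integral>x. \<bar>w x - (1 - f x)\<bar> \<partial>\<nu>)"
    by (intro Bochner_Integration.integral_cong) auto
  finally show "tv (\<lambda>x. 1 - f x) \<le> tv w + lam * (\<integral>x. \<bar>w x - (1 - f x)\<bar> \<partial>\<nu>)"
    by (simp add: tv_one_minus)
qed

lemma tv_eq_if_AE_eq:
  assumes "integrable \<nu> u" "integrable \<nu> w" "AE x in \<nu>. u x = w x"
  shows "tv u = tv w"
  using TV_cong_AE[OF assms(3)] by (simp add: TV_eq_tv assms tv_nonneg)

text \<open>
  The threshold is the supremum of \<open>(tv f - tv w) / \<parallel>w - f\<parallel>\<close>. Functions
  \<open>w\<close> at distance 0 from \<open>f\<close> impose no condition since they have the same total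
  variation; \<open>c\<close> bounds the quotients and \<open>ex\<close> provides at least one.
\<close>

lemma stability_threshold:
  assumes f: "integrable \<nu> f" and ex: "\<exists>w. integrable \<nu> w \<and> 0 < (\<integral>x. \<bar>w x - f x\<bar> \<partial>\<nu>)"
    and stable: "tv_stable f c"
  shows "\<exists>\<Lambda>. \<forall>lam. tv_stable f lam \<longleftrightarrow> \<Lambda> \<le> lam"
proof -
  define N where "N w = (\<integral>x. \<bar>w x - f x\<bar> \<partial>\<nu>)" for w
  define R where "R = {(tv f - tv w) / N w | w. integrable \<nu> w \<and> 0 < N w}"
  have R_le: "tv_stable f lam \<longleftrightarrow> (\<forall>r\<in>R. r \<le> lam)" for lam
  proof
    assume "tv_stable f lam"
    then show "\<forall>r\<in>R. r \<le> lam"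
      by (force simp: R_def tv_stable_def N_def field_simps)
  next
    assume R: "\<forall>r\<in>R. r \<le> lam"
    show "tv_stable f lam"
      unfolding tv_stable_def N_def [symmetric]
    proof (intro allI impI)
      fix w :: "'a \<Rightarrow> real" assume w: "integrable \<nu> w"
      show "tv f \<le> tv w + lam * N w"
      proof (cases "N w = 0")
        case True
        then have "AE x in \<nu>. \<bar>w x - f x\<bar> = 0"
          unfolding N_def using w f by (subst (asm) integral_nonneg_eq_0_iff_AE) auto
        then have "tv f = tv w"
          using w f by (intro tv_eq_if_AE_eq) auto
        then show ?thesis using True by simp
      next
        case False
        moreover have "0 \<le> N w" by (simp add: N_def)
        ultimately have "0 < N w" by simp
        then have "(tv f - tv w) / N w \<le> lam"
          using R w by (auto simp: R_def)
        then show ?thesis using \<open>0 < N w\<close> by (simp add: field_simps)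
      qed
    qed
  qed
  have "R \<noteq> {}" using ex by (auto simp: R_def N_def)
  moreover have "bdd_above R"
    using stable unfolding R_le by (auto intro: bdd_aboveI)
  ultimately have "tv_stable f lam \<longleftrightarrow> Sup R \<le> lam" for lam
    unfolding R_le by (simp add: cSup_le_iff)
  then show ?thesis by blast
qed

end

section \<open>Almost everywhere equality and completed measures\<close>

text \<open>
  Completeness makes every function that agrees almost everywhere with a measurable one measurable.
\<close>

lemma borel_measurable_completion_AE_eq:
  fixes u u' :: "'a \<Rightarrow> 'b::topological_space"
  assumes ae: "AE x in M. u x = u' x" and u': "u' \<in> borel_measurable M"
  shows "u \<in> borel_measurable (completion M)"
proof (rule measurableI)
  fix B :: "'b set" assume B: "B \<in> sets borel"
  show "u -` B \<inter> space (completion M) \<in> sets (completion M)"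
  proof (rule completion.in_sets_AE)
    show "u' -` B \<inter> space M \<in> sets (completion M)"
      using measurable_sets[OF u' B] by simp
    have "AE x in completion M. u x = u' x" using ae by (rule AE_completion)
    then show "AE x in completion M. x \<in> u' -` B \<inter> space M \<longleftrightarrow> x \<in> u -` B \<inter> space (completion M)"
      by eventually_elim auto
  qed auto
qed simp

lemma integral_completion_AE_eq:
  fixes u u' :: "'a \<Rightarrow> real"
  assumes ae: "AE x in M. u x = u' x" and u': "u' \<in> borel_measurable M"
  shows "(\<integral>x. u x \<partial>completion M) = (\<integral>x. u' x \<partial>M)"
proof -
  have "(\<integral>x. u x \<partial>completion M) = (\<integral>x. u' x \<partial>completion M)"
    by (rule integral_cong_AE)
      (auto intro: borel_measurable_completion_AE_eq[OF ae u'] measurable_completion[OF u'] AE_completion[OF ae])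
  then show ?thesis by (simp add: integral_completion[OF u'])
qed

lemma integrable_completion_AE_eq:
  fixes u u' :: "'a \<Rightarrow> real"
  assumes ae: "AE x in M. u x = u' x" and u': "u' \<in> borel_measurable M"
  shows "integrable (completion M) u \<longleftrightarrow> integrable M u'"
proof -
  have "integrable (completion M) u \<longleftrightarrow> integrable (completion M) u'"
    by (rule integrable_cong_AE)
      (auto intro: borel_measurable_completion_AE_eq[OF ae u'] measurable_completion[OF u'] AE_completion[OF ae])
  then show ?thesis by (simp add: integrable_completion[OF u'])
qed

lemma measure_completion_AE_eq:
  assumes ae: "AE x in M. x \<in> A \<longleftrightarrow> x \<in> B" and B: "B \<in> sets M" and A: "A \<subseteq> space M"
  shows "A \<in> sets (completion M)" and "measure (completion M) A = measure M B"
proof -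
  have ae': "AE x in completion M. x \<in> B \<longleftrightarrow> x \<in> A"
    using AE_completion[OF ae] by eventually_elim auto
  show A': "A \<in> sets (completion M)"
    by (rule completion.in_sets_AE[OF ae']) (use A B in auto)
  have "measure (completion M) B = measure (completion M) A"
    by (rule measure_eq_AE[OF ae']) (use A' B in auto)
  then show "measure (completion M) A = measure M B"
    using B by simp
qed

lemma L1_borel_representative:
  assumes "u \<in> L1 M"
  obtains u' where "integrable M u'" "AE x in M. u x = u' x"
proof -
  have u: "integrable (completion M) u" using assms by (simp add: L1_def)
  obtain u' where u': "u' \<in> borel_measurable M" "AE x in M. u x = u' x"
    using completion_ex_borel_measurable_real[OF borel_measurable_integrable[OF u]] by auto
  with u show thesis
    using integrable_completion_AE_eq[OF u'(2,1)] that by blast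
qed

lemma L1_I:
  assumes "integrable M u'" "AE x in M. u x = u' x"
  shows "u \<in> L1 M"
  using integrable_completion_AE_eq[OF assms(2) borel_measurable_integrable[OF assms(1)]] assms(1)
  by (simp add: L1_def)

lemma L2_subset_L1:
  assumes "finite_measure M" shows "L2 M \<subseteq> L1 M"
proof
  fix u assume "u \<in> L2 M"
  then have u: "u \<in> borel_measurable (completion M)" "integrable (completion M) (\<lambda>x. (u x)\<^sup>2)"
    by (auto simp: L2_def)
  interpret finite_measure M by fact
  have fin: "finite_measure (completion M)"
    by (rule finite_measureI) (simp add: emeasure_eq_measure)
  then interpret c: finite_measure "completion M" .
  have "integrable (completion M) u"
  proof (rule Bochner_Integration.integrable_bound)
    show "integrable (completion M) (\<lambda>x. 1 + (u x)\<^sup>2)" using u by simp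
    show "AE x in completion M. norm (u x) \<le> norm (1 + (u x)\<^sup>2)"
    proof (rule AE_I2)
      fix x
      have "0 \<le> (\<bar>u x\<bar> - 1)\<^sup>2" by simp
      then have "2 * \<bar>u x\<bar> \<le> 1 + (u x)\<^sup>2" by (simp add: power2_diff)
      then show "norm (u x) \<le> norm (1 + (u x)\<^sup>2)" by simp
    qed
  qed (use u in simp)
  then show "u \<in> L1 M" by (simp add: L1_def)
qed

lemma (in finite_measure) bounded_in_L2:
  assumes u': "u' \<in> borel_measurable M" and bd: "\<And>x. \<bar>u' x\<bar> \<le> B" and ae: "AE x in M. u x = u' x"
  shows "u \<in> L2 M"
proof -
  have "integrable M (\<lambda>x. (u' x)\<^sup>2)"
  proof (rule integrable_const_bound[of _ "B\<^sup>2"])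
    show "AE x in M. norm ((u' x)\<^sup>2) \<le> B\<^sup>2"
      using power_mono[OF bd, of _ 2] by simp
  qed (use u' in simp)
  moreover have "AE x in M. (u x)\<^sup>2 = (u' x)\<^sup>2"
    using ae by eventually_elim simp
  ultimately have "integrable (completion M) (\<lambda>x. (u x)\<^sup>2)"
    using u' by (subst integrable_completion_AE_eq[where u'="\<lambda>x. (u' x)\<^sup>2"]) auto
  then show ?thesis
    using borel_measurable_completion_AE_eq[OF ae u'] by (simp add: L2_def)
qed


section \<open>Minimizers, perimeters and eigenpairs\<close>

context reversible_walk
begin

lemma energy_eq:
  fixes u u' f f' :: "'a \<Rightarrow> real"
  assumes u: "integrable \<nu> u'" "AE x in \<nu>. u x = u' x"
    and f: "integrable \<nu> f'" "AE x in \<nu>. f x = f' x"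
  shows "energy m \<nu> u f lam = ereal (tv u' + lam * (\<integral>x. \<bar>u' x - f' x\<bar> \<partial>\<nu>))"
proof -
  have "AE x in \<nu>. \<bar>u x - f x\<bar> = \<bar>u' x - f' x\<bar>"
    using u(2) f(2) by eventually_elim simp
  then have "(\<integral>x. \<bar>u x - f x\<bar> \<partial>completion \<nu>) = (\<integral>x. \<bar>u' x - f' x\<bar> \<partial>\<nu>)"
    using u(1) f(1) by (intro integral_completion_AE_eq) auto
  then show ?thesis
    by (simp add: energy_def TV_cong_AE[OF u(2)] TV_eq_tv[OF u(1)] tv_nonneg)
qed

lemma minimizer_iff_stable:
  fixes f f' :: "'a \<Rightarrow> real"
  assumes f: "integrable \<nu> f'" "AE x in \<nu>. f x = f' x"
  shows "f \<in> minimizers m \<nu> f lam \<longleftrightarrow> tv_stable f' lam"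
proof
  assume "f \<in> minimizers m \<nu> f lam"
  then have min: "energy m \<nu> f f lam \<le> energy m \<nu> w f lam" if "w \<in> L1 \<nu>" for w
    using that by (simp add: minimizers_def)
  show "tv_stable f' lam"
    unfolding tv_stable_def
  proof (intro allI impI)
    fix w :: "'a \<Rightarrow> real" assume w: "integrable \<nu> w"
    have "w \<in> L1 \<nu>" using w by (rule L1_I) simp
    from min[OF this] show "tv f' \<le> tv w + lam * (\<integral>x. \<bar>w x - f' x\<bar> \<partial>\<nu>)"
      using w f energy_eq[OF f f] energy_eq[OF w _ f, of w] by simp
  qed
next
  assume stable: "tv_stable f' lam"
  show "f \<in> minimizers m \<nu> f lam"
    unfolding minimizers_def
  proof (intro CollectI conjI ballI)
    show "f \<in> L1 \<nu>" by (rule L1_I[OF f])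
    fix w assume "w \<in> L1 \<nu>"
    then obtain w' where w': "integrable \<nu> w'" "AE x in \<nu>. w x = w' x"
      by (rule L1_borel_representative)
    then show "energy m \<nu> f f lam \<le> energy m \<nu> w f lam"
      using stable w' by (simp add: energy_eq[OF f f] energy_eq[OF w' f] tv_stable_def)
  qed
qed

text \<open>
  Adding the strict excess \<open>(lam - \<Lambda>) * \<parallel>u - f\<parallel>\<close> to the inequality for
  \<open>\<Lambda>\<close> leaves no room for a second minimizer.
\<close>

lemma minimizers_eq_L1_class:
  fixes f f' :: "'a \<Rightarrow> real"
  assumes f: "integrable \<nu> f'" "AE x in \<nu>. f x = f' x"
    and stable: "tv_stable f' \<Lambda>" and lam: "\<Lambda> < lam"
  shows "minimizers m \<nu> f lam = L1_class \<nu> f"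
proof (intro subset_antisym subsetI)
  fix u assume "u \<in> minimizers m \<nu> f lam"
  then have uL: "u \<in> L1 \<nu>" and "energy m \<nu> u f lam \<le> energy m \<nu> f f lam"
    using L1_I[OF f] by (auto simp: minimizers_def)
  moreover obtain u' where u': "integrable \<nu> u'" "AE x in \<nu>. u x = u' x"
    using uL by (rule L1_borel_representative)
  ultimately have "tv u' + lam * (\<integral>x. \<bar>u' x - f' x\<bar> \<partial>\<nu>) \<le> tv f'"
    by (simp add: energy_eq[OF f f] energy_eq[OF u' f])
  also have "\<dots> \<le> tv u' + \<Lambda> * (\<integral>x. \<bar>u' x - f' x\<bar> \<partial>\<nu>)"
    using stable u' by (simp add: tv_stable_def)
  finally have "(lam - \<Lambda>) * (\<integral>x. \<bar>u' x - f' x\<bar> \<partial>\<nu>) \<le> 0"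
    by (simp add: left_diff_distrib)
  then have "(\<integral>x. \<bar>u' x - f' x\<bar> \<partial>\<nu>) \<le> 0"
    using lam by (simp add: mult_le_0_iff)
  then have "(\<integral>x. \<bar>u' x - f' x\<bar> \<partial>\<nu>) = 0"
    by (intro antisym) auto
  then have "AE x in \<nu>. \<bar>u' x - f' x\<bar> = 0"
    using u' f by (subst (asm) integral_nonneg_eq_0_iff_AE) auto
  with u'(2) f(2) have "AE x in \<nu>. u x = f x"
    by eventually_elim simp
  then show "u \<in> L1_class \<nu> f"
    using uL by (simp add: L1_class_def AE_completion)
next
  fix u assume "u \<in> L1_class \<nu> f"
  then have uL: "u \<in> L1 \<nu>" and "AE x in \<nu>. u x = f x"
    by (auto simp: L1_class_def AE_completion_iff)
  from this(2) f(2) have uf: "AE x in \<nu>. u x = f' x"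
    by eventually_elim simp
  have "tv_stable f' lam"
    unfolding tv_stable_def
  proof (intro allI impI)
    fix w :: "'a \<Rightarrow> real" assume "integrable \<nu> w"
    then have "tv f' \<le> tv w + \<Lambda> * (\<integral>x. \<bar>w x - f' x\<bar> \<partial>\<nu>)"
      using stable by (simp add: tv_stable_def)
    also have "\<dots> \<le> tv w + lam * (\<integral>x. \<bar>w x - f' x\<bar> \<partial>\<nu>)"
      using lam by (intro add_left_mono mult_right_mono) auto
    finally show "tv f' \<le> tv w + lam * (\<integral>x. \<bar>w x - f' x\<bar> \<partial>\<nu>)" .
  qed
  then have "f \<in> minimizers m \<nu> f lam"
    by (simp add: minimizer_iff_stable[OF f])
  moreover have "energy m \<nu> u f lam = energy m \<nu> f f lam"
    by (simp add: energy_eq[OF f f] energy_eq[OF f(1) uf f])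
  ultimately show "u \<in> minimizers m \<nu> f lam"
    using uL by (simp add: minimizers_def)
qed

lemma AE_indicator_eq:
  assumes "AE x in \<nu>. x \<in> A \<longleftrightarrow> x \<in> B"
  shows "AE x in \<nu>. indicat_real A x = indicat_real B x"
  using assms by eventually_elim (simp add: indicator_def)

lemma AE_measure_m_eq:
  assumes ae: "AE x in \<nu>. x \<in> A \<longleftrightarrow> x \<in> B" and B: "B \<in> sets borel"
  shows "AE x in \<nu>. measure (completion (m x)) A = measure (m x) B"
  using AE_AE_m[OF ae]
  by eventually_elim (rule measure_completion_AE_eq, use B in auto)

text \<open>
  The product of the indicator of \<open>B\<close> with the divergence of the cut flow of \<open>B\<close> is
  \<open>m\<^sub>x(X - B)\<close> on \<open>B\<close> and 0 elsewhere.
\<close>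

lemma perimeter_eq_tv:
  assumes ae: "AE x in \<nu>. x \<in> A \<longleftrightarrow> x \<in> B" and B [measurable]: "B \<in> sets borel"
  shows "perimeter m \<nu> A = tv (indicat_real B)"
proof -
  have [measurable]: "flow_div (cut_flow B) \<in> borel_measurable borel"
    by (rule measurable_flow_div[OF cut_flow(1)[OF B]])
  have ae': "AE x in \<nu>. x \<in> - A \<longleftrightarrow> x \<in> - B"
    using ae by eventually_elim auto
  have "AE x in \<nu>. indicat_real A x *\<^sub>R measure (completion (m x)) (- A)
      = flow_div (cut_flow B) x * indicat_real B x"
    using AE_indicator_eq[OF ae] AE_measure_m_eq[OF ae' borel_comp[OF B]]
  proof eventually_elim
    case (elim x)
    have "measure (m x) (- B) = 1 - measure (m x) B"
      using m.prob_compl[of B x] by (simp add: Compl_eq_Diff_UNIV)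
    then show ?case
      using elim by (auto simp: cut_flow(5)[OF B] indicator_def)
  qed
  then have "perimeter m \<nu> A = (\<integral>x. flow_div (cut_flow B) x * indicat_real B x \<partial>\<nu>)"
    unfolding perimeter_def set_lebesgue_integral_def
    by (rule integral_completion_AE_eq) simp
  then show ?thesis by (simp add: tv_indicator_eq[OF B])
qed

text \<open>
  From left to right, test functions in \<open>L\<^sup>1\<close> are first clamped to \<open>[0, 1]\<close>,
  which brings them into \<open>L\<^sup>2\<close> and increases neither the total variation nor the distance
  to \<open>f\<close>. From right to left, the calibration \<open>v\<close> is equal to \<open>lam\<close> on
  \<open>B\<close> because of \<open>v \<le> lam\<close> and \<open>\<integral> v * f = lam *
  \<nu>(B)\<close>, and the required selection of the sign is 1 on \<open>B\<close> and \<open>v / lam\<close>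
  elsewhere.
\<close>

lemma eigenpair_iff_stable:
  fixes A B :: "'a set"
  assumes ae: "AE x in \<nu>. x \<in> A \<longleftrightarrow> x \<in> B" and B [measurable]: "B \<in> sets borel"
    and pos: "0 < measure \<nu> B"
    and lam: "lam = tv (indicat_real B) / measure \<nu> B"
  shows "eigenpair m \<nu> lam (\<lambda>x. 1 / measure (completion \<nu>) A * indicat_real A x)
    \<longleftrightarrow> tv_stable (indicat_real B) lam"
proof -
  define c where "c = 1 / measure \<nu> B"
  define f where "f = indicat_real B"
  define u where "u x = c * indicat_real A x" for x
  have c: "0 < c" "c * measure \<nu> B = 1" using pos by (auto simp: c_def)
  have lam0: "0 \<le> lam" unfolding lam by (simp add: tv_nonneg)
  have tvf: "tv f = lam * measure \<nu> B" using pos by (simp add: lam f_def)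
  have [measurable]: "f \<in> borel_measurable borel" unfolding f_def by simp
  have f01: "f x = 0 \<or> f x = 1" for x by (auto simp: f_def indicator_def)
  have int_f: "integrable \<nu> f" unfolding f_def by (rule integrable_indicator_real[OF B])
  have integral_f: "(\<integral>x. f x \<partial>\<nu>) = measure \<nu> B" by (simp add: f_def)
  have u_ae: "AE x in \<nu>. u x = c * f x"
    using AE_indicator_eq[OF ae] by eventually_elim (simp add: u_def f_def)
  have int_cf: "integrable \<nu> (\<lambda>x. c * f x)" using int_f by simp
  have TV_u: "TV m \<nu> u = ennreal (c * tv f)"
    using c(1) by (simp add: TV_cong_AE[OF u_ae] TV_eq_tv[OF int_cf] tv_scale)
  have u_L2: "u \<in> L2 \<nu>"
    by (rule bounded_in_L2[OF _ _ u_ae, of c]) (use c(1) in \<open>auto simp: f_def indicator_def\<close>)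
  have "(\<lambda>x. 1 / measure (completion \<nu>) A * indicat_real A x) = u"
    using measure_completion_AE_eq(2)[OF ae] B by (simp add: u_def [abs_def] c_def)
  then have eig: "eigenpair m \<nu> lam (\<lambda>x. 1 / measure (completion \<nu>) A * indicat_real A x)
      \<longleftrightarrow> eigenpair m \<nu> lam u" by simp
  have "eigenpair m \<nu> lam u \<longleftrightarrow> tv_stable f lam"
  proof
    assume "eigenpair m \<nu> lam u"
    then obtain \<xi> where \<xi>: "\<xi> \<in> sign_selections \<nu> u"
      and "(\<lambda>x. - (lam * \<xi> x)) \<in> one_laplacian m \<nu> u"
      by (auto simp: eigenpair_def)
    then have sub: "enn2ereal (TV m \<nu> u) + ereal (\<integral>x. lam * \<xi> x * (w x - u x) \<partial>completion \<nu>)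
        \<le> enn2ereal (TV m \<nu> w)" if "w \<in> L2 \<nu>" for w
      using that by (simp add: one_laplacian_def subdifferential_def TV_functional_def)
    have \<xi>_meas: "\<xi> \<in> borel_measurable (completion \<nu>)"
      using \<xi> by (simp add: sign_selections_def)
    have "AE x in completion \<nu>. (u x > 0 \<longrightarrow> \<xi> x = 1) \<and> (u x < 0 \<longrightarrow> \<xi> x = -1) \<and> (u x = 0 \<longrightarrow> \<xi> x \<in> {-1..1})"
      using \<xi> by (simp add: sign_selections_def)
    then have \<xi>_bd: "AE x in \<nu>. \<bar>\<xi> x\<bar> \<le> 1"
      unfolding AE_completion_iff
    proof eventually_elim
      case (elim x)
      then show ?case by (cases "u x" "0::real" rule: linorder_cases) auto
    qed
    obtain \<xi>' where \<xi>'_meas: "\<xi>' \<in> borel_measurable \<nu>" and \<xi>': "AE x in \<nu>. \<xi> x = \<xi>' x"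
      using completion_ex_borel_measurable_real[OF \<xi>_meas] by auto
    note [measurable] = \<xi>'_meas
    have \<xi>'_bd: "AE x in \<nu>. \<bar>\<xi>' x\<bar> \<le> 1"
      using \<xi>_bd \<xi>' by eventually_elim simp
    show "tv_stable f lam"
      unfolding tv_stable_def
    proof (intro allI impI)
      fix w :: "'a \<Rightarrow> real" assume w: "integrable \<nu> w"
      then have [measurable]: "w \<in> borel_measurable borel"
        using borel_measurable_integrable[OF w] by simp
      \<comment> \<open>\<open>f\<close> has values in \<open>{0, 1}\<close>, so clamping only decreases the distance to \<open>f\<close>\<close>
      define w1 where "w1 x = max 0 (min 1 (w x))" for x
      have w1_bd: "\<bar>w1 x\<bar> \<le> 1" for x by (simp add: w1_def)
      have [measurable]: "w1 \<in> borel_measurable borel" unfolding w1_def by measurable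
      have int_w1: "integrable \<nu> w1"
        by (rule integrable_const_bound[of _ 1]) (auto simp: w1_bd)
      have int_cw1: "integrable \<nu> (\<lambda>x. c * w1 x)" using int_w1 by simp
      have int_d: "integrable \<nu> (\<lambda>x. w1 x - f x)" using int_w1 int_f by simp
      have cw1_L2: "(\<lambda>x. c * w1 x) \<in> L2 \<nu>"
        by (rule bounded_in_L2[of "\<lambda>x. c * w1 x" c]) (use c(1) w1_bd in \<open>auto simp: abs_mult\<close>)
      have "AE x in \<nu>. lam * \<xi> x * (c * w1 x - u x) = lam * \<xi>' x * (c * w1 x - c * f x)"
        using \<xi>' u_ae by eventually_elim simp
      then have "(\<integral>x. lam * \<xi> x * (c * w1 x - u x) \<partial>completion \<nu>)
          = (\<integral>x. lam * \<xi>' x * (c * w1 x - c * f x) \<partial>\<nu>)"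
        by (rule integral_completion_AE_eq) simp
      also have "\<dots> = (\<integral>x. (c * lam) * (\<xi>' x * (w1 x - f x)) \<partial>\<nu>)"
        by (intro Bochner_Integration.integral_cong) (auto simp: algebra_simps)
      finally have I: "(\<integral>x. lam * \<xi> x * (c * w1 x - u x) \<partial>completion \<nu>)
          = c * lam * (\<integral>x. \<xi>' x * (w1 x - f x) \<partial>\<nu>)" by simp
      have "TV m \<nu> (\<lambda>x. c * w1 x) = ennreal (c * tv w1)"
        using c(1) by (simp add: TV_eq_tv[OF int_cw1] tv_scale)
      with sub[OF cw1_L2] have "c * tv f + c * lam * (\<integral>x. \<xi>' x * (w1 x - f x) \<partial>\<nu>) \<le> c * tv w1"
        using c(1) by (simp add: TV_u I tv_nonneg)
      then have "c * (tv f + lam * (\<integral>x. \<xi>' x * (w1 x - f x) \<partial>\<nu>)) \<le> c * tv w1"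
        by (simp add: algebra_simps)
      then have le: "tv f + lam * (\<integral>x. \<xi>' x * (w1 x - f x) \<partial>\<nu>) \<le> tv w1"
        using c(1) by simp
      have "(\<integral>x. - \<bar>w1 x - f x\<bar> \<partial>\<nu>) \<le> (\<integral>x. \<xi>' x * (w1 x - f x) \<partial>\<nu>)"
      proof (rule integral_mono_AE)
        have bd: "AE x in \<nu>. \<bar>\<xi>' x * (w1 x - f x)\<bar> \<le> \<bar>w1 x - f x\<bar>"
          using \<xi>'_bd by eventually_elim (auto simp: abs_mult intro!: mult_left_le_one_le)
        show "integrable \<nu> (\<lambda>x. \<xi>' x * (w1 x - f x))"
          by (rule Bochner_Integration.integrable_bound[OF int_d]) (use bd in auto)
        show "AE x in \<nu>. - \<bar>w1 x - f x\<bar> \<le> \<xi>' x * (w1 x - f x)"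
          using bd by eventually_elim linarith
      qed (use int_d in simp)
      also have "(\<integral>x. - \<bar>w1 x - f x\<bar> \<partial>\<nu>) = - (\<integral>x. \<bar>w1 x - f x\<bar> \<partial>\<nu>)" by simp
      finally have "lam * - (\<integral>x. \<bar>w1 x - f x\<bar> \<partial>\<nu>) \<le> lam * (\<integral>x. \<xi>' x * (w1 x - f x) \<partial>\<nu>)"
        using lam0 by (intro mult_left_mono) auto
      then have "tv f \<le> tv w1 + lam * (\<integral>x. \<bar>w1 x - f x\<bar> \<partial>\<nu>)"
        using le by simp
      also have "\<dots> \<le> tv w + lam * (\<integral>x. \<bar>w x - f x\<bar> \<partial>\<nu>)"
      proof (intro add_mono mult_left_mono integral_mono)
        show "tv w1 \<le> tv w" unfolding w1_def [abs_def] by (rule tv_clamp_le[OF w])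
        show "\<bar>w1 x - f x\<bar> \<le> \<bar>w x - f x\<bar>" for x
          using f01[of x] by (auto simp: w1_def)
      qed (use int_d w int_f lam0 in auto)
      finally show "tv f \<le> tv w + lam * (\<integral>x. \<bar>w x - f x\<bar> \<partial>\<nu>)" .
    qed
  next
    assume "tv_stable f lam"
    then have opt: "tv (indicat_real B) \<le> tv w + lam * (\<integral>x. \<bar>w x - indicat_real B x\<bar> \<partial>\<nu>)"
      if "integrable \<nu> w" for w
      using that unfolding tv_stable_def f_def by blast
    obtain v where [measurable]: "v \<in> borel_measurable borel"
      and v1: "\<And>x. \<bar>v x\<bar> \<le> 1" and v_lam: "AE x in \<nu>. \<bar>v x\<bar> \<le> lam"
      and v_le: "\<And>w. integrable \<nu> w \<Longrightarrow> (\<integral>x. v x * w x \<partial>\<nu>) \<le> tv w"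
      and v_eq: "(\<integral>x. v x * f x \<partial>\<nu>) = tv f"
      using calibration_of_minimizer[OF B lam0 opt] unfolding f_def by blast
    note int_v = integrable_bounded_mult[OF _ \<open>v \<in> borel_measurable borel\<close> v1]
    have v_on_B: "AE x in \<nu>. (lam - v x) * f x = 0"
    proof -
      have "integrable \<nu> (\<lambda>x. (lam - v x) * f x)"
        using int_f int_v[OF int_f] by (simp add: left_diff_distrib)
      moreover have "AE x in \<nu>. 0 \<le> (lam - v x) * f x"
        using v_lam
      proof eventually_elim
        case (elim x)
        then show ?case using f01[of x] by auto
      qed
      moreover have "(\<integral>x. (lam - v x) * f x \<partial>\<nu>) = 0"
        using int_f int_v[OF int_f] by (simp add: left_diff_distrib v_eq tvf integral_f)
      ultimately show ?thesis by (simp add: integral_nonneg_eq_0_iff_AE)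
    qed
    \<comment> \<open>for \<open>lam = 0\<close> the quotient is 0 by convention, and \<open>v = 0\<close> almost everywhere\<close>
    define \<xi> where "\<xi> x = (if x \<in> B then 1 else v x / lam)" for x
    have [measurable]: "\<xi> \<in> borel_measurable borel" unfolding \<xi>_def by measurable
    have \<xi>_v: "AE x in \<nu>. lam * \<xi> x = v x"
      using v_on_B v_lam
    proof eventually_elim
      case (elim x)
      then show ?case by (cases "lam = 0") (auto simp: \<xi>_def f_def)
    qed
    have \<xi>_bd: "AE x in \<nu>. \<bar>\<xi> x\<bar> \<le> 1"
      using v_lam
    proof eventually_elim
      case (elim x)
      then show ?case using lam0 by (cases "lam = 0") (auto simp: \<xi>_def field_simps)
    qed
    have \<xi>_sign: "\<xi> \<in> sign_selections \<nu> u"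
      unfolding sign_selections_def AE_completion_iff
    proof (intro CollectI conjI)
      show "\<xi> \<in> borel_measurable (completion \<nu>)" by (rule measurable_completion) simp
      show "AE x in \<nu>. (u x > 0 \<longrightarrow> \<xi> x = 1) \<and> (u x < 0 \<longrightarrow> \<xi> x = -1) \<and> (u x = 0 \<longrightarrow> \<xi> x \<in> {-1..1})"
        using \<xi>_bd u_ae
      proof eventually_elim
        case (elim x)
        have "x \<in> B \<Longrightarrow> \<xi> x = 1" by (simp add: \<xi>_def)
        then show ?case
          using elim c(1) by (cases "x \<in> B") (auto simp: f_def abs_le_iff)
      qed
    qed
    have "(\<lambda>x. lam * \<xi> x) \<in> subdifferential \<nu> (TV_functional m \<nu>) u"
      unfolding subdifferential_def TV_functional_def
    proof (intro CollectI conjI ballI)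
      show "(\<lambda>x. lam * \<xi> x) \<in> L2 \<nu>"
        by (rule bounded_in_L2[of v 1]) (use v1 \<xi>_v in auto)
      show "u \<in> L2 \<nu>" by (rule u_L2)
      show "enn2ereal (TV m \<nu> u) < \<infinity>"
        using c(1) by (simp add: TV_u tv_nonneg)
      fix w assume "w \<in> L2 \<nu>"
      then have "w \<in> L1 \<nu>" using L2_subset_L1[OF finite_measure_axioms] by auto
      then obtain w' where w': "integrable \<nu> w'" "AE x in \<nu>. w x = w' x"
        by (rule L1_borel_representative)
      have [measurable]: "w' \<in> borel_measurable borel"
        using borel_measurable_integrable[OF w'(1)] by simp
      have "AE x in \<nu>. lam * \<xi> x * (w x - u x) = v x * w' x - c * (v x * f x)"
        using w'(2) u_ae \<xi>_v by eventually_elim (simp add: algebra_simps)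
      then have "(\<integral>x. lam * \<xi> x * (w x - u x) \<partial>completion \<nu>) = (\<integral>x. v x * w' x - c * (v x * f x) \<partial>\<nu>)"
        by (rule integral_completion_AE_eq) simp
      also have "\<dots> = (\<integral>x. v x * w' x \<partial>\<nu>) - c * tv f"
        using int_v[OF w'(1)] int_v[OF int_f] by (simp add: v_eq)
      also have "\<dots> \<le> tv w' - c * tv f"
        using v_le[OF w'(1)] by simp
      finally show "enn2ereal (TV m \<nu> u) + ereal (\<integral>x. lam * \<xi> x * (w x - u x) \<partial>completion \<nu>)
          \<le> enn2ereal (TV m \<nu> w)"
        using c(1) by (simp add: TV_u TV_cong_AE[OF w'(2)] TV_eq_tv[OF w'(1)] tv_nonneg)
    qed
    moreover have "(\<integral>x. \<bar>u x\<bar> \<partial>completion \<nu>) = 1"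
    proof -
      have "AE x in \<nu>. \<bar>u x\<bar> = c * f x"
        using u_ae
      proof eventually_elim
        case (elim x)
        then show ?case using c(1) f01[of x] by auto
      qed
      then have "(\<integral>x. \<bar>u x\<bar> \<partial>completion \<nu>) = (\<integral>x. c * f x \<partial>\<nu>)"
        by (rule integral_completion_AE_eq) simp
      then show ?thesis by (simp add: integral_f c)
    qed
    ultimately show "eigenpair m \<nu> lam u"
      using u_L2 \<xi>_sign by (auto simp: eigenpair_def one_laplacian_def)
  qed
  then show ?thesis unfolding eig f_def .
qed

lemma lambda_ratio_eq:
  assumes "AE x in \<nu>. x \<in> A \<longleftrightarrow> x \<in> B" and "B \<in> sets borel"
  shows "lambda_ratio m \<nu> A = tv (indicat_real B) / measure \<nu> B"
  using measure_completion_AE_eq(2)[OF assms(1)] assms(2)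
  by (simp add: lambda_ratio_def perimeter_eq_tv[OF assms])

lemma lambda_ratio_le_stable:
  assumes B [measurable]: "B \<in> sets borel" and pos: "0 < measure \<nu> B"
    and stable: "tv_stable (indicat_real B) lam"
  shows "tv (indicat_real B) / measure \<nu> B \<le> lam"
proof -
  have "tv (indicat_real B) \<le> tv (\<lambda>_. 0) + lam * (\<integral>x. \<bar>0 - indicat_real B x\<bar> \<partial>\<nu>)"
    using stable unfolding tv_stable_def by (elim allE[of _ "\<lambda>_. 0"] impE) simp_all
  then show ?thesis
    using pos by (simp add: tv_const field_simps)
qed

lemma lambda_star_stable:
  assumes ae: "AE x in \<nu>. x \<in> A \<longleftrightarrow> x \<in> B" and B: "B \<in> sets borel"
    and c: "lambda_star m \<nu> A = ereal c"
  shows "tv_stable (indicat_real B) c"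
proof -
  have "AE x in \<nu>. ereal \<bar>indicat_real A x - measure (completion (m x)) A\<bar> \<le> ereal c"
    using esssup_AE[of "\<lambda>x. ereal \<bar>indicat_real A x - measure (completion (m x)) A\<bar>" "completion \<nu>"] c
    unfolding lambda_star_def AE_completion_iff by simp
  with AE_indicator_eq[OF ae] AE_measure_m_eq[OF ae B]
  have "AE x in \<nu>. \<bar>flow_div (cut_flow B) x\<bar> \<le> c"
    by eventually_elim (simp add: cut_flow(5)[OF B])
  then show ?thesis
    unfolding tv_stable_def using tv_indicator_le[OF B] by blast
qed

lemma lambda_star_not_MInfty:
  "lambda_star m \<nu> A \<noteq> - \<infinity>"
proof
  assume "lambda_star m \<nu> A = - \<infinity>"
  then have "AE x in \<nu>. ereal \<bar>indicat_real A x - measure (completion (m x)) A\<bar> \<le> - \<infinity>"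
    using esssup_AE[of "\<lambda>x. ereal \<bar>indicat_real A x - measure (completion (m x)) A\<bar>" "completion \<nu>"]
    unfolding lambda_star_def AE_completion_iff by simp
  then have "AE x in \<nu>. False" by simp
  then show False
    using fin by (simp add: AE_iff_measurable[OF _ refl] finite_nonzero_borel_measure_def)
qed

end


section \<open>The threshold\<close>

theorem proposition3p30:
  fixes m :: "'a::polish_space \<Rightarrow> 'a measure"
    and \<nu> :: "'a measure"
    and \<Omega> :: "'a set"
  assumes "random_walk m"
    and "finite_nonzero_borel_measure \<nu>"
    and "reversible m \<nu>"
    and "ergodic m \<nu>"
    and "\<Omega> \<in> sets (completion \<nu>)"
    and "0 < emeasure (completion \<nu>) \<Omega>"
    and "emeasure (completion \<nu>) \<Omega> < emeasure (completion \<nu>) UNIV"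
  shows "\<exists>\<Lambda>::real.
      max (lambda_ratio m \<nu> \<Omega>) (lambda_ratio m \<nu> (- \<Omega>)) \<le> \<Lambda> \<and>
      ereal \<Lambda> \<le> lambda_star m \<nu> \<Omega> \<and>
      (\<forall>lam. 0 < lam \<and> lam < \<Lambda> \<longrightarrow> indicat_real \<Omega> \<notin> minimizers m \<nu> (indicat_real \<Omega>) lam) \<and>
      indicat_real \<Omega> \<in> minimizers m \<nu> (indicat_real \<Omega>) \<Lambda> \<and>
      (\<forall>lam. \<Lambda> < lam \<longrightarrow>
        minimizers m \<nu> (indicat_real \<Omega>) lam = L1_class \<nu> (indicat_real \<Omega>)) \<and>
      (\<Lambda> = lambda_ratio m \<nu> \<Omega> \<longleftrightarrow>
        eigenpair m \<nu> (lambda_ratio m \<nu> \<Omega>)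
          (\<lambda>x. 1 / measure (completion \<nu>) \<Omega> * indicat_real \<Omega> x)) \<and>
      (\<Lambda> = lambda_ratio m \<nu> (- \<Omega>) \<longleftrightarrow>
        eigenpair m \<nu> (lambda_ratio m \<nu> (- \<Omega>))
          (\<lambda>x. 1 / measure (completion \<nu>) (- \<Omega>) * indicat_real (- \<Omega>) x))"
proof -
  interpret reversible_walk m \<nu>
    using assms(1-3) by unfold_locales
  define B where "B = main_part \<nu> \<Omega>"
  have B [measurable]: "B \<in> sets borel"
    using main_part_sets[OF assms(5)] by (simp add: B_def)
  have B' [measurable]: "- B \<in> sets borel" using B by (rule borel_comp)
  have ae: "AE x in \<nu>. x \<in> \<Omega> \<longleftrightarrow> x \<in> B"
    using AE_in_main_part[OF assms(5)] unfolding B_def by eventually_elim simp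
  have ae': "AE x in \<nu>. x \<in> - \<Omega> \<longleftrightarrow> x \<in> - B"
    using ae by eventually_elim simp
  have pos: "0 < measure \<nu> B"
    using assms(5,6) by (simp add: B_def emeasure_eq_measure ennreal_less_iff)
  have "measure \<nu> B < measure \<nu> UNIV"
    using assms(5,7) by (simp add: B_def emeasure_eq_measure ennreal_less_iff)
  then have pos': "0 < measure \<nu> (- B)"
    using finite_measure_compl[of B] by (simp add: Compl_eq_Diff_UNIV)
  let ?f = "indicat_real B"
  have compl: "indicat_real (- B) = (\<lambda>x. 1 - ?f x)"
    by (auto simp: indicator_def)
  have f: "integrable \<nu> ?f" "AE x in \<nu>. indicat_real \<Omega> x = ?f x"
    using integrable_indicator_real[OF B] AE_indicator_eq[OF ae] by auto
  have stable_compl: "tv_stable (indicat_real (- B)) lam \<longleftrightarrow> tv_stable ?f lam" for lam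
    using tv_stable_one_minus[of ?f lam] tv_stable_one_minus[of "indicat_real (- B)" lam]
    by (auto simp: compl)
  have "\<exists>\<Lambda>. \<forall>lam. tv_stable ?f lam \<longleftrightarrow> \<Lambda> \<le> lam"
  proof (rule stability_threshold[OF f(1)])
    show "\<exists>w. integrable \<nu> w \<and> 0 < (\<integral>x. \<bar>w x - ?f x\<bar> \<partial>\<nu>)"
      using pos by (intro exI[of _ "\<lambda>_. 0"]) simp
    have "\<bar>flow_div (cut_flow B) x\<bar> \<le> 1" for x
      by (rule abs_flow_div_le_1) (fact cut_flow[OF B])+
    then show "tv_stable ?f 1"
      unfolding tv_stable_def using tv_indicator_le[OF B, of _ 1] by auto
  qed
  then obtain \<Lambda> where \<Lambda>: "\<And>lam. tv_stable ?f lam \<longleftrightarrow> \<Lambda> \<le> lam" by blast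
  have lower: "lambda_ratio m \<nu> \<Omega> \<le> \<Lambda>" "lambda_ratio m \<nu> (- \<Omega>) \<le> \<Lambda>"
    using lambda_ratio_le_stable[OF B pos, of \<Lambda>] lambda_ratio_le_stable[OF B' pos', of \<Lambda>]
    by (simp_all add: lambda_ratio_eq[OF ae B] lambda_ratio_eq[OF ae' B'] stable_compl \<Lambda>)
  have eig: "\<Lambda> = lambda_ratio m \<nu> \<Omega> \<longleftrightarrow> eigenpair m \<nu> (lambda_ratio m \<nu> \<Omega>)
          (\<lambda>x. 1 / measure (completion \<nu>) \<Omega> * indicat_real \<Omega> x)"
    unfolding eigenpair_iff_stable[OF ae B pos lambda_ratio_eq[OF ae B]] \<Lambda> using lower by auto
  have eig': "\<Lambda> = lambda_ratio m \<nu> (- \<Omega>) \<longleftrightarrow> eigenpair m \<nu> (lambda_ratio m \<nu> (- \<Omega>))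
          (\<lambda>x. 1 / measure (completion \<nu>) (- \<Omega>) * indicat_real (- \<Omega>) x)"
    unfolding eigenpair_iff_stable[OF ae' B' pos' lambda_ratio_eq[OF ae' B']] stable_compl \<Lambda>
    using lower by auto
  have "ereal \<Lambda> \<le> lambda_star m \<nu> \<Omega>"
  proof (cases "lambda_star m \<nu> \<Omega>")
    case (real c)
    then show ?thesis using lambda_star_stable[OF ae B real] by (simp add: \<Lambda>)
  next
    case PInf
    then show ?thesis by simp
  next
    case MInf
    then show ?thesis using lambda_star_not_MInfty[of \<Omega>] by simp
  qed
  then show ?thesis
    using lower eig eig' minimizers_eq_L1_class[OF f, of \<Lambda>]
    by (intro exI[of _ \<Lambda>]) (simp add: minimizer_iff_stable[OF f] \<Lambda>)
qed

end
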